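(* Let $\mathbb{T}$ be a fixed gateset for which sDCS is promiseBQP-complete. Then every language in (promise) BQP has a one-one polynomial-time reduction to sDCS, i.e. for every $\mathcal{L}_{bqp}$ in promiseBQP there is an injective classical polynomial-time computable map $\mathcal{R}$ with $x\in\mathcal{L}_{bqp}\iff\mathcal{R}(x)\in\mathcal{L}_{\textit{sDCS}}$.
   Context: An instance of Simplified Decision Quantum Circuit Simulation (sDCS) is an ordered set $\mathbb{G}$ of gates from a fixed gateset $\mathbb{T}$ on $n$ qubits; the circuit starts from $|0^n\rangle$, applies the gates of $\mathbb{G}$ in order, and measures every qubit in the computational basis at the end; the task is to output the most likely outcome of the last measurement, under the promise that each outcome probability lies in $[0,1/3]\cup[2/3,1]$. Instances are encoded as strings over a finite alphabet by listing, for each gate, a symbol for the gate type followed by a fixed-length string indexing the qubit it acts on; $\mathcal{L}_{\textit{sDCS}}$ is the set of encoded instances whose outcome $1$ has probability at least $2/3$. A reduction from $\mathcal{L}_A$ to $\mathcal{L}_B$ is a map $\mathcal{R}$ with $x\in\mathcal{L}_A\iff\mathcal{R}(x)\in\mathcal{L}_B$; it is one-one if $\mathcal{R}$ is injective. *)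

theory Defs
  imports Complex_Main "Jordan_Normal_Form.Schur_Decomposition"
begin

section \<open>Polynomial-time computable string functions\<close>

text \<open>
  Strings over a finite alphabet of size \<open>q\<close> are elements of \<open>lists {..<q}\<close>.
  The machine model is the deterministic multi-tape Turing machine with two-way infinite tapes.
  Tape symbol \<open>0\<close> is the blank; the string symbol \<open>a\<close> is written on a tape as \<open>Suc a\<close>.
  The states are \<open>0, \<dots>, num_states\<close>; \<open>0\<close> is initial and \<open>num_states\<close> is the halting state.
\<close>

datatype direction = Left | Stay | Right

record tm =
  num_states :: nat
  num_tapes :: nat
  num_symbols :: nat
  trans :: "nat \<Rightarrow> nat list \<Rightarrow> nat \<times> (nat \<times> direction) list"

definition wf_tm :: "tm \<Rightarrow> bool" where
  "wf_tm M \<longleftrightarrow> 0 < num_tapes M \<and>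
     (\<forall>s < num_states M. \<forall>r \<in> lists {..<num_symbols M}. length r = num_tapes M \<longrightarrow>
        (case trans M s r of (s', acts) \<Rightarrow>
           s' \<le> num_states M \<and> length acts = num_tapes M \<and>
           fst ` set acts \<subseteq> {..<num_symbols M}))"

type_synonym tape = "(int \<Rightarrow> nat) \<times> int"

fun read :: "tape \<Rightarrow> nat" where
  "read (c, h) = c h"

fun act :: "nat \<times> direction \<Rightarrow> tape \<Rightarrow> tape" where
  "act (a, d) (c, h) =
     (c(h := a), case d of Left \<Rightarrow> h - 1 | Stay \<Rightarrow> h | Right \<Rightarrow> h + 1)"

type_synonym config = "nat \<times> tape list"

fun step :: "tm \<Rightarrow> config \<Rightarrow> config" where
  "step M (s, tps) =
     (if s < num_states M
      then (case trans M s (map read tps) of (s', acts) \<Rightarrow> (s', map2 act acts tps))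
      else (s, tps))"

definition input_tape :: "nat list \<Rightarrow> tape" where
  "input_tape x = (\<lambda>i. if 0 \<le> i \<and> i < int (length x) then Suc (x ! nat i) else 0, 0)"

definition blank_tape :: tape where
  "blank_tape = (\<lambda>i. 0, 0)"

definition start_config :: "tm \<Rightarrow> nat list \<Rightarrow> config" where
  "start_config M x = (0, input_tape x # replicate (num_tapes M - 1) blank_tape)"

text \<open>The output is read from the head position rightwards, up to the first blank.\<close>

fun tape_output :: "tape \<Rightarrow> nat list \<Rightarrow> bool" where
  "tape_output (c, h) y \<longleftrightarrow>
     (\<forall>i < length y. c (h + int i) = Suc (y ! i)) \<and> c (h + int (length y)) = 0"

text \<open>A halted configuration is a fixed point of \<^const>\<open>step\<close>, so this says that the machine
  halts after at most \<open>t\<close> steps.\<close>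

definition computes_within :: "tm \<Rightarrow> nat list \<Rightarrow> nat list \<Rightarrow> nat \<Rightarrow> bool" where
  "computes_within M x y t \<longleftrightarrow>
     (case (step M ^^ t) (start_config M x) of (s, tps) \<Rightarrow>
        s = num_states M \<and> tape_output (last tps) y)"

definition polytime :: "nat \<Rightarrow> (nat list \<Rightarrow> nat list) \<Rightarrow> bool" where
  "polytime q f \<longleftrightarrow>
     (\<exists>M. \<exists>p :: nat poly. wf_tm M \<and> q < num_symbols M \<and>
        (\<forall>x \<in> lists {..<q}. computes_within M x (f x) (poly p (length x))))"

section \<open>Promise problems and reductions\<close>

record promise_problem =
  alph :: nat
  yes :: "nat list set"
  no :: "nat list set"

definition wf_problem :: "promise_problem \<Rightarrow> bool" where
  "wf_problem A \<longleftrightarrow> yes A \<union> no A \<subseteq> lists {..<alph A} \<and> yes A \<inter> no A = {}"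

definition polytime_reduction ::
  "promise_problem \<Rightarrow> promise_problem \<Rightarrow> (nat list \<Rightarrow> nat list) \<Rightarrow> bool" where
  "polytime_reduction A B R \<longleftrightarrow>
     polytime (alph A) R \<and>
     R ` lists {..<alph A} \<subseteq> lists {..<alph B} \<and>
     (\<forall>x \<in> yes A \<union> no A. R x \<in> yes B \<union> no B \<and> (x \<in> yes A \<longleftrightarrow> R x \<in> yes B))"

section \<open>Quantum circuits\<close>

text \<open>
  A gate on \<open>k\<close> qubits is a unitary matrix of dimension \<open>2 ^ k\<close>.  A circuit over a gateset \<open>T\<close>
  lists pairs \<open>(g, qs)\<close>: the gate \<open>T ! g\<close> is applied to the qubits \<open>qs\<close>, in this order.
\<close>

definition gateset :: "complex mat list \<Rightarrow> bool" where
  "gateset T \<longleftrightarrow> (\<forall>U \<in> set T. \<exists>k \<ge> 1. U \<in> carrier_mat (2 ^ k) (2 ^ k) \<and>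
     mat_adjoint U * U = 1\<^sub>m (2 ^ k))"

type_synonym circuit = "(nat \<times> nat list) list"

definition valid_circuit :: "complex mat list \<Rightarrow> circuit \<Rightarrow> bool" where
  "valid_circuit T C \<longleftrightarrow> C \<noteq> [] \<and>
     (\<forall>(g, qs) \<in> set C. g < length T \<and> distinct qs \<and> dim_row (T ! g) = 2 ^ length qs)"

text \<open>The number \<open>n\<close> of qubits: the gates act on the qubits \<open>0, \<dots>, n - 1\<close>, and \<open>n\<close> is the
  least such number.\<close>

definition num_qubits :: "circuit \<Rightarrow> nat" where
  "num_qubits C = Suc (Max (\<Union>(g, qs) \<in> set C. set qs))"

text \<open>
  The computational basis state \<open>|b\<^sub>0 \<dots> b\<^sub>n\<^sub>-\<^sub>1\<rangle>\<close> is represented by the set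
  \<open>{i. i < n \<and> b\<^sub>i = 1}\<close>, and a state by its amplitudes in this basis.  The rows and columns of
  a gate matrix are indexed by the values of the qubits it acts on, the first qubit being the
  most significant bit.
\<close>

type_synonym state = "nat set \<Rightarrow> complex"

definition basis_state :: "nat set \<Rightarrow> state" where
  "basis_state B = (\<lambda>S. if S = B then 1 else 0)"

definition bits_value :: "nat list \<Rightarrow> nat set \<Rightarrow> nat" where
  "bits_value qs S = foldl (\<lambda>v q. 2 * v + of_bool (q \<in> S)) 0 qs"

definition apply_gate :: "complex mat \<Rightarrow> nat list \<Rightarrow> state \<Rightarrow> state" where
  "apply_gate U qs \<psi> = (\<lambda>S. \<Sum>A \<in> Pow (set qs).
     U $$ (bits_value qs S, bits_value qs A) * \<psi> ((S - set qs) \<union> A))"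

definition run :: "complex mat list \<Rightarrow> circuit \<Rightarrow> state \<Rightarrow> state" where
  "run T C = fold (\<lambda>(g, qs). apply_gate (T ! g) qs) C"

definition outcome_prob :: "state \<Rightarrow> nat set \<Rightarrow> real" where
  "outcome_prob \<psi> S = (cmod (\<psi> S))\<^sup>2"

text \<open>All \<open>n\<close> qubits are measured, in the order \<open>0, \<dots>, n - 1\<close>; the last measurement is the
  one of qubit \<open>n - 1\<close>, and its outcome is \<open>b\<close> with the following probability.  The set \<open>B\<close> is
  the initial basis state.\<close>

definition last_outcome_prob :: "complex mat list \<Rightarrow> circuit \<Rightarrow> nat set \<Rightarrow> bool \<Rightarrow> real" where
  "last_outcome_prob T C B b = (let n = num_qubits C in
     \<Sum>S | S \<subseteq> {..<n} \<and> (n - 1 \<in> S \<longleftrightarrow> b). outcome_prob (run T C (basis_state B)) S)"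

section \<open>Encoding of circuits\<close>

text \<open>
  The alphabet consists of the bits \<open>0\<close>, \<open>1\<close> and of a symbol \<open>g + 2\<close> for the gate type \<open>g\<close>.
  Indices in a circuit on \<open>n\<close> qubits are written in binary, most significant bit first, with
  the shortest positive length that suffices for \<open>n\<close> indices.
\<close>

definition index_length :: "nat \<Rightarrow> nat" where
  "index_length n = (LEAST l. 0 < l \<and> n \<le> 2 ^ l)"

definition index_string :: "nat \<Rightarrow> nat \<Rightarrow> nat list" where
  "index_string l i = map (\<lambda>j. of_bool (bit i j)) (rev [0..<l])"

definition encode :: "circuit \<Rightarrow> nat list" where
  "encode C = (let l = index_length (num_qubits C) in
     concat (map (\<lambda>(g, qs). (g + 2) # concat (map (index_string l) qs)) C))"

section \<open>The problem sDCS\<close>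

definition sDCS_promise :: "complex mat list \<Rightarrow> circuit \<Rightarrow> bool" where
  "sDCS_promise T C \<longleftrightarrow> valid_circuit T C \<and>
     (\<forall>b. last_outcome_prob T C {} b \<in> {0..1/3} \<union> {2/3..1})"

definition sDCS :: "complex mat list \<Rightarrow> promise_problem" where
  "sDCS T = \<lparr>
     alph = 2 + length T,
     yes = {encode C | C. sDCS_promise T C \<and> last_outcome_prob T C {} True \<ge> 2/3},
     no = {encode C | C. sDCS_promise T C \<and> \<not> last_outcome_prob T C {} True \<ge> 2/3}\<rparr>"

section \<open>The class promiseBQP\<close>

definition hadamard_gate :: "complex mat" where
  "hadamard_gate = mat_of_rows_list 2
     [[1 / sqrt 2, 1 / sqrt 2],
      [1 / sqrt 2, - 1 / sqrt 2]]"

definition T_gate :: "complex mat" where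
  "T_gate = mat_of_rows_list 2
     [[1, 0],
      [0, cis (pi / 4)]]"

definition cnot_gate :: "complex mat" where
  "cnot_gate = mat_of_rows_list 4
     [[1, 0, 0, 0],
      [0, 1, 0, 0],
      [0, 0, 0, 1],
      [0, 0, 1, 0]]"

definition std_gates :: "complex mat list" where
  "std_gates = [hadamard_gate, T_gate, cnot_gate]"

text \<open>The input string is loaded into the first qubits, every symbol being written in binary
  with the same number of bits (a single bit if the alphabet is binary).\<close>

definition input_bits :: "nat \<Rightarrow> nat list \<Rightarrow> nat list" where
  "input_bits q x = concat (map (index_string (index_length q)) x)"

definition input_basis :: "nat \<Rightarrow> nat list \<Rightarrow> nat set" where
  "input_basis q x = {i. i < length (input_bits q x) \<and> input_bits q x ! i = 1}"

text \<open>A uniform family has one circuit for every input length \<open>n\<close>, whose encoding is computed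
  in polynomial time from \<open>n\<close> in unary, i.e. from the string of length \<open>n\<close> over a one-letter
  alphabet.\<close>

definition promiseBQP :: "promise_problem set" where
  "promiseBQP = {A. wf_problem A \<and>
     (\<exists>C :: nat \<Rightarrow> circuit.
        (\<forall>n. valid_circuit std_gates (C n) \<and> n * index_length (alph A) \<le> num_qubits (C n)) \<and>
        polytime 1 (\<lambda>u. encode (C (length u))) \<and>
        (\<forall>x \<in> yes A.
           last_outcome_prob std_gates (C (length x)) (input_basis (alph A) x) True \<ge> 2/3) \<and>
        (\<forall>x \<in> no A.
           last_outcome_prob std_gates (C (length x)) (input_basis (alph A) x) True \<le> 1/3))}"

definition promiseBQP_complete :: "promise_problem \<Rightarrow> bool" where
  "promiseBQP_complete B \<longleftrightarrow> B \<in> promiseBQP \<and>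
     (\<forall>A \<in> promiseBQP. \<exists>R. polytime_reduction A B R)"

end

theory Submission
  imports Defs
begin

text \<open>
  Let \<open>R\<^sub>0\<close> be any polynomial-time reduction to sDCS, as provided by completeness.  Given \<open>x\<close>, with
  \<open>R\<^sub>0 x\<close> encoding a circuit \<open>C\<close>, the new reduction outputs a circuit that runs one copy of \<open>C\<close> for
  every symbol of \<open>x\<close>, on a register determined by the symbol, and finally \<open>C\<close> itself on another
  register, which has the highest indices.  The last measured qubit is the last qubit of the final copy, and since all gates
  are unitary, its outcome distribution is that of \<open>C\<close>.

  The registers are chosen such that the encoding changes locally: in the copy for the symbol \<open>a\<close>,
  every bit of every qubit index is preceded by the \<open>m\<close>-bit code of \<open>a\<close> (by \<open>m\<close> ones in the final
  copy).  Hence a Turing machine can produce the output without parsing the qubit indices, and \<open>x\<close>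
  can be read off the output.
\<close>

section \<open>Padded strings\<close>

definition pad_block :: "nat \<Rightarrow> nat \<Rightarrow> nat \<Rightarrow> nat list" where
  "pad_block m a s = (if s < 2 then index_string m a @ [s] else [s])"

definition pad_copy :: "nat \<Rightarrow> nat list \<Rightarrow> nat \<Rightarrow> nat list" where
  "pad_copy m y a = concat (map (pad_block m a) y)"

text \<open>Encodings of circuits contain a bit and are not changed by the following function; it matters
  for the injectivity of the reduction outside the promise.\<close>

definition ensure_bit :: "nat list \<Rightarrow> nat list" where
  "ensure_bit y = (if \<exists>s \<in> set y. s < 2 then y else y @ [0])"

definition pad :: "nat \<Rightarrow> nat list \<Rightarrow> nat list \<Rightarrow> nat list" where
  "pad m y x = concat (map (pad_copy m (ensure_bit y)) (x @ [2 ^ m - 1]))"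

section \<open>Turing machines\<close>

definition reaches :: "tm \<Rightarrow> nat \<Rightarrow> config \<Rightarrow> config \<Rightarrow> bool" where
  "reaches M n c c' \<longleftrightarrow> (\<exists>t \<le> n. (step M ^^ t) c = c')"

lemma reaches_refl: "reaches M n c c"
  unfolding reaches_def by (rule exI[of _ 0]) simp

lemma reaches_step: "step M c = c' \<Longrightarrow> reaches M 1 c c'"
  unfolding reaches_def by (rule exI[of _ 1]) simp

lemma reaches_trans:
  assumes "reaches M n c c'" and "reaches M n' c' c''"
  shows "reaches M (n + n') c c''"
proof -
  obtain t t' where t: "t \<le> n" "(step M ^^ t) c = c'" and t': "t' \<le> n'" "(step M ^^ t') c' = c''"
    using assms unfolding reaches_def by blast
  then have "(step M ^^ (t' + t)) c = c''"
    by (simp add: funpow_add)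
  with t t' show ?thesis
    unfolding reaches_def by (intro exI[of _ "t' + t"]) simp
qed

lemma reaches_mono: "reaches M n c c' \<Longrightarrow> n \<le> n' \<Longrightarrow> reaches M n' c c'"
  unfolding reaches_def using order_trans by blast

lemma step_halted: "\<not> s < num_states M \<Longrightarrow> (step M ^^ t) (s, tps) = (s, tps)"
  by (induction t) auto

lemma reaches_halted:
  assumes "reaches M n c (num_states M, tps)"
  shows "(step M ^^ n) c = (num_states M, tps)"
proof -
  obtain t where t: "t \<le> n" "(step M ^^ t) c = (num_states M, tps)"
    using assms unfolding reaches_def by blast
  have "(step M ^^ n) c = (step M ^^ (n - t + t)) c"
    using t by simp
  also have "\<dots> = (num_states M, tps)"
    unfolding funpow_add using t step_halted[of "num_states M" M] by simp
  finally show ?thesis .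
qed

definition content :: "nat list \<Rightarrow> int \<Rightarrow> nat" where
  "content x = (\<lambda>i. if 0 \<le> i \<and> i < int (length x) then Suc (x ! nat i) else 0)"

lemma input_tape_content: "input_tape x = (content x, 0)"
  by (simp add: input_tape_def content_def)

lemma content_Nil: "content [] = (\<lambda>i. 0)"
  by (auto simp: content_def)

lemma content_nth: "i < length x \<Longrightarrow> content x (int i) = Suc (x ! i)"
  by (simp add: content_def)

lemma content_beyond: "i < 0 \<or> int (length x) \<le> i \<Longrightarrow> content x i = 0"
  by (auto simp: content_def)

lemma content_snoc: "(content u)(int (length u) := Suc s) = content (u @ [s])"
  by (rule ext) (auto simp: content_def nth_append)

lemma content_Cons: "content (s # w) i = (if i = 0 then Suc s else content w (i - 1))"
  by (auto simp: content_def nth_Cons nat_diff_distrib split: nat.splits)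

text \<open>The string \<open>w\<close> on a tape that is written from right to left.\<close>

definition out_tape :: "nat list \<Rightarrow> tape" where
  "out_tape w = (\<lambda>i. content w (i + int (length w) - 1), - int (length w))"

lemma out_tape_Nil: "out_tape [] = blank_tape"
  by (auto simp: out_tape_def blank_tape_def content_def)

lemma read_out_tape: "read (out_tape w) = 0"
  by (simp add: out_tape_def content_def)

lemma act_out_tape: "act (Suc s, Left) (out_tape w) = out_tape (s # w)"
  by (auto simp: out_tape_def content_Cons algebra_simps intro!: ext)

lemma tape_output_out_tape: "tape_output (act (0, Right) (out_tape w)) w"
  by (auto simp: out_tape_def content_def)

definition stay :: "nat list \<Rightarrow> (nat \<times> direction) list" where
  "stay rs = map (\<lambda>a. (a, Stay)) rs"

lemma length_stay [simp]: "length (stay rs) = length rs"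
  by (simp add: stay_def)

lemma act_stay: "act (read t, Stay) t = t"
  by (cases t) simp

lemma map2_act_stay_update:
  "map2 act ((stay (map read ts))[i := a]) ts = ts[i := act a (ts ! i)]"
proof (rule nth_equalityI)
  fix k assume "k < length (map2 act ((stay (map read ts))[i := a]) ts)"
  then show "map2 act ((stay (map read ts))[i := a]) ts ! k = ts[i := act a (ts ! i)] ! k"
    by (cases "k = i") (simp_all add: stay_def act_stay)
qed simp

lemma map2_act_stay: "map2 act (stay (map read ts)) ts = ts"
  by (rule nth_equalityI) (auto simp: stay_def act_stay)

lemma fst_set_stay: "fst ` set (stay rs) = set rs"
  by (force simp: stay_def)

lemma fst_set_stay_update: "fst ` set ((stay rs)[i := (a, d)]) \<subseteq> insert a (set rs)"
proof -
  have "fst ` set ((stay rs)[i := (a, d)]) \<subseteq> fst ` insert (a, d) (set (stay rs))"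
    by (intro image_mono set_update_subset_insert)
  then show ?thesis
    by (simp add: fst_set_stay)
qed

definition good_config :: "tm \<Rightarrow> config \<Rightarrow> bool" where
  "good_config M = (\<lambda>(s, ts). s \<le> num_states M \<and> length ts = num_tapes M \<and>
     (\<forall>t \<in> set ts. \<forall>i. fst t i < num_symbols M))"

lemma trans_good:
  assumes "wf_tm M" "good_config M (s, ts)" "s < num_states M"
    "trans M s (map read ts) = (s', acts)"
  shows "s' \<le> num_states M" "length acts = num_tapes M" "fst ` set acts \<subseteq> {..<num_symbols M}"
proof -
  have r: "map read ts \<in> lists {..<num_symbols M}"
    using assms(2) by (fastforce simp: good_config_def)
  have len: "length (map read ts) = num_tapes M"
    using assms(2) by (simp add: good_config_def)
  have "case trans M s (map read ts) of (s', acts) \<Rightarrow>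
           s' \<le> num_states M \<and> length acts = num_tapes M \<and>
           fst ` set acts \<subseteq> {..<num_symbols M}"
    using assms(1)[unfolded wf_tm_def, THEN conjunct2, rule_format, OF assms(3) r len] .
  then show "s' \<le> num_states M" "length acts = num_tapes M" "fst ` set acts \<subseteq> {..<num_symbols M}"
    using assms(4) by auto
qed

lemma good_config_step:
  assumes "wf_tm M" "good_config M c"
  shows "good_config M (step M c)"
proof (cases c)
  case (Pair s ts)
  show ?thesis
  proof (cases "s < num_states M")
    case True
    obtain s' acts where tr: "trans M s (map read ts) = (s', acts)"
      by (rule prod.exhaust)
    note tg = trans_good[OF assms(1) assms(2)[unfolded Pair] True tr]
    have "fst t i < num_symbols M" if t: "t \<in> set (map2 act acts ts)" for t i
    proof -
      obtain a d u where u: "((a, d), u) \<in> set (zip acts ts)" "t = act (a, d) u"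
        using t by auto
      have "(a, d) \<in> set acts" "u \<in> set ts"
        using u(1) by (auto dest: set_zip_leftD set_zip_rightD)
      then have "a < num_symbols M" "fst u i < num_symbols M"
        using tg(3) assms(2) Pair by (auto simp: good_config_def)
      then show ?thesis
        using u(2) by (cases u) simp
    qed
    then show ?thesis
      using tg assms(2) True tr Pair by (simp add: good_config_def)
  qed (use assms Pair in simp)
qed

lemma good_config_run:
  "wf_tm M \<Longrightarrow> good_config M c \<Longrightarrow> good_config M ((step M ^^ t) c)"
  by (induction t) (auto intro: good_config_step)

lemma good_config_start:
  assumes "wf_tm M" "x \<in> lists {..<q}" "q < num_symbols M"
  shows "good_config M (start_config M x)"
proof -
  have "Suc (x ! nat i) < num_symbols M" if "0 \<le> i" "i < int (length x)" for i
  proof -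
    have "x ! nat i \<in> set x"
      using that by (intro nth_mem) (simp add: nat_less_iff)
    then show ?thesis
      using assms(2,3) by auto
  qed
  then have "fst (input_tape x) i < num_symbols M" for i
    using assms(3) by (simp add: input_tape_def)
  then show ?thesis
    using assms by (auto simp: good_config_def start_config_def wf_tm_def blank_tape_def)
qed

lemma nonblank_cells_step:
  assumes "\<forall>t \<in> set (snd c). finite {i. fst t i \<noteq> 0} \<and> card {i. fst t i \<noteq> 0} \<le> n"
  shows "\<forall>t \<in> set (snd (step M c)). finite {i. fst t i \<noteq> 0} \<and> card {i. fst t i \<noteq> 0} \<le> Suc n"
proof (cases c)
  case (Pair s ts)
  show ?thesis
  proof (cases "s < num_states M")
    case True
    obtain s' acts where tr: "trans M s (map read ts) = (s', acts)"
      by (rule prod.exhaust)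
    have "finite {i. fst t i \<noteq> 0} \<and> card {i. fst t i \<noteq> 0} \<le> Suc n"
      if t: "t \<in> set (map2 act acts ts)" for t
    proof -
      obtain a d u where u: "((a, d), u) \<in> set (zip acts ts)" "t = act (a, d) u"
        using t by auto
      then have fin: "finite {i. fst u i \<noteq> 0}" "card {i. fst u i \<noteq> 0} \<le> n"
        using assms Pair by (auto dest: set_zip_rightD)
      have sub: "{i. fst t i \<noteq> 0} \<subseteq> insert (snd u) {i. fst u i \<noteq> 0}"
        using u(2) by (cases u) auto
      have "card {i. fst t i \<noteq> 0} \<le> card (insert (snd u) {i. fst u i \<noteq> 0})"
        using fin sub by (intro card_mono) auto
      also have "\<dots> \<le> Suc n"
        using fin card_insert_le_m1 by (simp add: card_insert_if)
      finally show ?thesis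
        using fin sub finite_subset by blast
    qed
    then show ?thesis
      using True tr Pair by simp
  qed (use assms Pair in \<open>auto intro: le_SucI\<close>)
qed

lemma nonblank_cells_run:
  assumes "(step M ^^ n) (start_config M x) = (s, ts)" "t \<in> set ts"
  shows "finite {i. fst t i \<noteq> 0} \<and> card {i. fst t i \<noteq> 0} \<le> length x + n"
proof -
  have "\<forall>t \<in> set (snd ((step M ^^ n) (start_config M x))).
    finite {i. fst t i \<noteq> 0} \<and> card {i. fst t i \<noteq> 0} \<le> length x + n"
  proof (induction n)
    case 0
    have sub: "{i. fst (input_tape x) i \<noteq> 0} \<subseteq> int ` {..<length x}"
    proof
      fix i assume "i \<in> {i. fst (input_tape x) i \<noteq> 0}"
      then have "i = int (nat i)" "nat i < length x"
        by (auto simp: input_tape_def split: if_splits)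
      then show "i \<in> int ` {..<length x}"
        by blast
    qed
    then have "card {i. fst (input_tape x) i \<noteq> 0} \<le> card (int ` {..<length x})"
      by (intro card_mono) auto
    also have "\<dots> = length x"
      by (simp add: card_image)
    finally show ?case
      using finite_subset[OF sub] by (auto simp: start_config_def blank_tape_def)
  next
    case (Suc n)
    show ?case
      using nonblank_cells_step[OF Suc.IH, of M] by simp
  qed
  then show ?thesis
    using assms by simp
qed

lemma length_output_le:
  assumes "(step M ^^ n) (start_config M x) = (s, ts)" "t \<in> set ts" "tape_output t y"
  shows "length y \<le> length x + n"
proof (cases t)
  case (Pair c h)
  note fin = nonblank_cells_run[OF assms(1,2)]
  have "(\<lambda>i. h + int i) ` {..<length y} \<subseteq> {i. fst t i \<noteq> 0}"
    using assms(3) Pair by auto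
  then have "card ((\<lambda>i. h + int i) ` {..<length y}) \<le> card {i. fst t i \<noteq> 0}"
    using fin by (intro card_mono) auto
  then show ?thesis
    using fin by (simp add: card_image inj_on_def)
qed

section \<open>A machine for padded strings\<close>

text \<open>Besides the tapes of \<open>M\<close>, there are a tape with a copy of the input, a tape with a copy of
  the output \<open>y\<close> of \<open>M\<close>, and the output tape, which is written from right to left.  The states are:
  \<open>0\<close> (copying the input), \<open>1\<close> (rewinding the input tape of \<open>M\<close>), \<open>s + 2\<close> (\<open>M\<close> is in state \<open>s\<close>),
  \<open>copy_state f\<close> (copying \<open>y\<close>; \<open>f\<close> tells whether a bit has been seen), \<open>next_state\<close> (rewinding
  \<open>y\<close> and fetching the next symbol of the input) and \<open>emit_state a j\<close> (writing the copy of \<open>y\<close>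
  for the symbol \<open>a\<close>; \<open>j\<close> symbols of the current block have been written).\<close>

locale pad_machine =
  fixes M :: tm and m :: nat
  assumes wf_M: "wf_tm M"
begin

definition copy_state :: "bool \<Rightarrow> nat" where
  "copy_state f = num_states M + 2 + of_bool f"

definition next_state :: nat where
  "next_state = num_states M + 4"

definition emit_state :: "nat \<Rightarrow> nat \<Rightarrow> nat" where
  "emit_state a j = num_states M + 5 + (a * Suc m + j)"

definition final_state :: nat where
  "final_state = num_states M + 5 + 2 ^ m * Suc m"

type_synonym action = "nat \<times> direction"

definition delta :: "nat \<Rightarrow> nat list \<Rightarrow> nat \<Rightarrow> nat \<Rightarrow> nat \<Rightarrow>
    nat \<times> action list \<times> action \<times> action \<times> action" where
  "delta s r x y z =
    (if s = 0 then
       if hd r \<noteq> 0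
       then (0, (stay r)[0 := (hd r, Right)], (hd r, Right), (y, Stay), (z, Stay))
       else (1, (stay r)[0 := (0, Left)], (x, Stay), (y, Stay), (z, Stay))
     else if s = 1 then
       if hd r \<noteq> 0
       then (1, (stay r)[0 := (hd r, Left)], (x, Stay), (y, Stay), (z, Stay))
       else (2, (stay r)[0 := (0, Right)], (x, Stay), (y, Stay), (z, Stay))
     else if s < copy_state False then
       (case trans M (s - 2) r of (s', acts) \<Rightarrow>
          if s' \<le> num_states M \<and> length acts = num_tapes M \<and>
             fst ` set acts \<subseteq> {..<num_symbols M}
          then (s' + 2, acts, (x, Stay), (y, Stay), (z, Stay))
          else (final_state, stay r, (x, Stay), (y, Stay), (z, Stay)))
     else if s < next_state then
       if last r \<noteq> 0
       then (copy_state (s = copy_state True \<or> last r \<le> 2),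
             (stay r)[length r - 1 := (last r, Right)], (x, Stay), (last r, Right), (z, Stay))
       else (emit_state (2 ^ m - 1) 0, stay r, (x, Left),
             if s = copy_state True then (y, Left) else (1, Stay), (z, Stay))
     else if s = next_state then
       if y \<noteq> 0 then (next_state, stay r, (x, Stay), (y, Right), (z, Stay))
       else if x \<noteq> 0
       then (emit_state (min (x - 1) (2 ^ m - 1)) 0, stay r, (x, Left), (0, Left), (z, Stay))
       else (final_state, stay r, (x, Stay), (0, Stay), (z, Right))
     else
       let a = (s - emit_state 0 0) div Suc m; j = (s - emit_state 0 0) mod Suc m in
       if y = 0 then (next_state, stay r, (x, Stay), (0, Right), (z, Stay))
       else (if 2 < y \<or> j = m then emit_state a 0 else emit_state a (Suc j),
             stay r, (x, Stay), (y, if 2 < y \<or> j = m then Left else Stay),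
             (if j = 0 then y else Suc (of_bool (bit a (j - 1))), Left)))"

definition machine :: tm where
  "machine = \<lparr>num_states = final_state, num_tapes = num_tapes M + 3,
     num_symbols = max (num_symbols M) 3,
     trans = \<lambda>s r. case delta s (take (num_tapes M) r) (r ! num_tapes M)
         (r ! (num_tapes M + 1)) (r ! (num_tapes M + 2)) of
       (s', acts, ax, ay, az) \<Rightarrow> (s', acts @ [ax, ay, az])\<rparr>"

lemma emit_state_less: "a < 2 ^ m \<Longrightarrow> j \<le> m \<Longrightarrow> emit_state a j < final_state"
proof -
  assume "a < 2 ^ m" "j \<le> m"
  then have "a * Suc m + j < Suc a * Suc m" "Suc a * Suc m \<le> 2 ^ m * Suc m"
    by (simp, intro mult_le_mono1) simp
  then show ?thesis
    unfolding emit_state_def final_state_def by linarith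
qed

lemma emit_state_decode:
  "j \<le> m \<Longrightarrow> (emit_state a j - emit_state 0 0) div Suc m = a"
  "j \<le> m \<Longrightarrow> (emit_state a j - emit_state 0 0) mod Suc m = j"
  unfolding emit_state_def by (simp_all del: mult_Suc_right add: div_mult_self1)

lemma state_order:
  "1 < copy_state f" "copy_state f < next_state" "next_state < final_state"
  "copy_state f < copy_state False \<longleftrightarrow> False"
  by (auto simp: copy_state_def next_state_def final_state_def)

lemma delta_copy_state:
  "delta (copy_state f) r x y z =
    (if last r \<noteq> 0
     then (copy_state (f \<or> last r \<le> 2), (stay r)[length r - 1 := (last r, Right)], (x, Stay),
           (last r, Right), (z, Stay))
     else (emit_state (2 ^ m - 1) 0, stay r, (x, Left), if f then (y, Left) else (1, Stay), (z, Stay)))"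
  by (cases f) (simp_all add: delta_def copy_state_def next_state_def)

lemma delta_next_state:
  "delta next_state r x y z =
    (if y \<noteq> 0 then (next_state, stay r, (x, Stay), (y, Right), (z, Stay))
     else if x \<noteq> 0
     then (emit_state (min (x - 1) (2 ^ m - 1)) 0, stay r, (x, Left), (0, Left), (z, Stay))
     else (final_state, stay r, (x, Stay), (0, Stay), (z, Right)))"
  by (simp add: delta_def copy_state_def next_state_def)

lemma delta_emit_state:
  assumes "j \<le> m"
  shows "delta (emit_state a j) r x y z =
    (if y = 0 then (next_state, stay r, (x, Stay), (0, Right), (z, Stay))
     else (if 2 < y \<or> j = m then emit_state a 0 else emit_state a (Suc j),
           stay r, (x, Stay), (y, if 2 < y \<or> j = m then Left else Stay),
           (if j = 0 then y else Suc (of_bool (bit a (j - 1))), Left)))"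
proof -
  have "emit_state a j \<noteq> 0" "emit_state a j \<noteq> 1" "\<not> emit_state a j < copy_state False"
    "\<not> emit_state a j < next_state" "emit_state a j \<noteq> next_state"
    by (simp_all add: emit_state_def copy_state_def next_state_def)
  then show ?thesis
    unfolding delta_def using emit_state_decode(1,2)[OF assms] by (simp add: Let_def)
qed

lemma delta_wf:
  assumes "s < final_state" and r: "set r \<subseteq> {..<S}" "length r = num_tapes M"
    and S: "x < S" "y < S" "z < S" "3 \<le> S" "num_symbols M \<le> S"
    and d: "delta s r x y z = (s', acts, ax, ay, az)"
  shows "s' \<le> final_state \<and> length acts = num_tapes M \<and> fst ` set acts \<subseteq> {..<S} \<and>
    fst ax < S \<and> fst ay < S \<and> fst az < S"
proof -
  define ok where "ok as \<longleftrightarrow> length as = num_tapes M \<and> fst ` set as \<subseteq> {..<S}" for as :: "action list"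
  have "r \<noteq> []"
    using r wf_M by (auto simp: wf_tm_def)
  then have hl: "hd r < S" "last r < S" "0 < S" "1 < S" "Suc 0 < S"
    using r S by (auto dest: hd_in_set last_in_set)
  have upd: "ok ((stay r)[i := (a, e)])" if "a < S" for i a e
    using fst_set_stay_update[of r i a e] r that by (auto simp: ok_def)
  have st: "ok (stay r)"
    using r by (simp add: fst_set_stay ok_def)
  have ord: "next_state \<le> final_state" "copy_state f \<le> final_state" "2 \<le> final_state" "1 \<le> final_state"
    "t \<le> num_states M \<Longrightarrow> t + 2 \<le> final_state" for f t
    by (auto simp: copy_state_def next_state_def final_state_def)
  have em: "emit_state a j \<le> final_state" if "a < 2 ^ m" "j \<le> m" for a j
    using emit_state_less[OF that] by simp
  have mark: "emit_state (2 ^ m - 1) 0 \<le> final_state" "emit_state (min k (2 ^ m - 1)) 0 \<le> final_state" for k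
    by (auto intro!: em intro: le_less_trans[OF min.cobounded2])
  have sub: "ok as" if "length as = num_tapes M" "fst ` set as \<subseteq> {..<num_symbols M}" for as
    using S that by (auto simp: ok_def)
  have bs: "Suc (of_bool b) < S" for b
    using S by (cases b) auto
  consider "s = 0" | "s = 1" | "1 < s" "s < copy_state False" | f where "s = copy_state f"
    | "s = next_state" | "next_state < s"
    unfolding copy_state_def next_state_def
    by (cases "s = num_states M + 2"; cases "s = num_states M + 3") force+
  then have "s' \<le> final_state \<and> ok acts \<and> fst ax < S \<and> fst ay < S \<and> fst az < S"
  proof cases
    case 1
    then show ?thesis
      using d upd hl S ord by (auto simp: delta_def split: if_splits)
  next
    case 2
    then show ?thesis
      using d upd hl S ord by (auto simp: delta_def split: if_splits)
  next
    case 3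
    obtain s2 as where tr: "trans M (s - 2) r = (s2, as)"
      by (rule prod.exhaust)
    show ?thesis
      using 3 d S st sub[of as] ord(5)[of s2] by (auto simp: delta_def tr split: if_splits)
  next
    case 4
    then show ?thesis
      using d upd st hl S ord mark by (auto simp: delta_copy_state split: if_splits)
  next
    case 5
    then show ?thesis
      using d st hl S ord mark by (auto simp: delta_next_state split: if_splits)
  next
    case 6
    define e where "e = s - emit_state 0 0"
    have "0 < 2 ^ m * Suc m"
      by simp
    then have "e < 2 ^ m * Suc m"
      using assms(1) unfolding e_def emit_state_def final_state_def by linarith
    then have a: "e div Suc m < 2 ^ m"
      by (rule less_mult_imp_div_less)
    have j: "e mod Suc m \<le> m"
      using mod_less_divisor[of "Suc m" e] by linarith
    have "s = emit_state 0 0 + e"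
      using 6 unfolding e_def next_state_def emit_state_def by simp
    also have "\<dots> = emit_state (e div Suc m) (e mod Suc m)"
      unfolding emit_state_def by (simp only: div_mult_mod_eq)
    finally have s: "s = emit_state (e div Suc m) (e mod Suc m)" .
    have em': "emit_state (e div Suc m) (Suc (e mod Suc m)) \<le> final_state" if "e mod Suc m \<noteq> m"
      using j that by (intro em a) linarith
    show ?thesis
      using d[unfolded s delta_emit_state[OF j]] st hl S ord bs em[OF a, of 0] em'
      by (auto split: if_splits)
  qed
  then show ?thesis
    by (simp add: ok_def)
qed

lemma wf_machine: "wf_tm machine"
  unfolding wf_tm_def
proof (intro conjI allI impI ballI)
  show "0 < num_tapes machine"
    by (simp add: machine_def)
  fix s r
  assume s: "s < num_states machine" and r: "r \<in> lists {..<num_symbols machine}"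
    and len: "length r = num_tapes machine"
  let ?K = "num_tapes M" and ?S = "max (num_symbols M) 3"
  obtain s' acts ax ay az where d:
    "delta s (take ?K r) (r ! ?K) (r ! (?K + 1)) (r ! (?K + 2)) = (s', acts, ax, ay, az)"
    by (metis prod_cases5)
  have set: "set r \<subseteq> {..<?S}"
    using r by (auto simp: machine_def)
  have "s' \<le> final_state \<and> length acts = ?K \<and> fst ` set acts \<subseteq> {..<?S} \<and>
    fst ax < ?S \<and> fst ay < ?S \<and> fst az < ?S"
  proof (rule delta_wf[OF _ _ _ _ _ _ _ _ d])
    show "set (take ?K r) \<subseteq> {..<?S}"
      using set set_take_subset by fastforce
    have nth: "k < length r \<Longrightarrow> r ! k < ?S" for k
      using set nth_mem by blast
    show "r ! ?K < ?S" "r ! (?K + 1) < ?S" "r ! (?K + 2) < ?S"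
      using len by (auto intro!: nth simp: machine_def simp del: max_less_iff_conj less_max_iff_disj)
  qed (use s len in \<open>auto simp: machine_def\<close>)
  then show "case trans machine s r of (s', acts) \<Rightarrow>
       s' \<le> num_states machine \<and> length acts = num_tapes machine \<and>
       fst ` set acts \<subseteq> {..<num_symbols machine}"
    using d by (simp add: machine_def)
qed

lemma step_machine:
  assumes "length ts = num_tapes M" "s < final_state"
    and "delta s (map read ts) (read X) (read Y) (read Z) = (s', acts, ax, ay, az)"
    and "length acts = num_tapes M"
  shows "step machine (s, ts @ [X, Y, Z]) = (s', map2 act acts ts @ [act ax X, act ay Y, act az Z])"
  using assms by (simp add: machine_def nth_append)

lemma reaches_machine:
  assumes "delta s (map read ts) (read X) (read Y) (read Z) = (s', acts, ax, ay, az)"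
    and "length ts = num_tapes M" "s < final_state" "length acts = num_tapes M"
    and "map2 act acts ts = ts'" "act ax X = X'" "act ay Y = Y'" "act az Z = Z'"
    and "reaches machine n (s', ts' @ [X', Y', Z']) c"
  shows "reaches machine (Suc n) (s, ts @ [X, Y, Z]) c"
proof -
  have "step machine (s, ts @ [X, Y, Z]) = (s', ts' @ [X', Y', Z'])"
    using step_machine[OF assms(2,3,1,4)] assms(5-8) by simp
  from reaches_trans[OF reaches_step[OF this] assms(9)] show ?thesis
    by simp
qed

lemma map2_act_head:
  "map2 act ((stay (map read ((c, h) # ts)))[0 := (c h, d)]) ((c, h) # ts) = act (c h, d) (c, h) # ts"
  by (simp only: map2_act_stay_update list_update_code nth_Cons_0)

lemma reaches_copy_input:
  assumes "tape_output (c, h) v" "Suc (length ts) = num_tapes M"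
  shows "reaches machine (Suc (length v))
    (0, ((c, h) # ts) @ [(content u, int (length u)), Y, Z])
    (1, ((c, h + int (length v) - 1) # ts) @ [(content (u @ v), int (length (u @ v))), Y, Z])"
  using assms(1)
proof (induction v arbitrary: h u)
  case Nil
  let ?acts = "(stay (map read ((c, h) # ts)))[0 := (c h, Left)]"
  show ?case
  proof (rule reaches_machine[where acts = ?acts])
    show "map2 act ?acts ((c, h) # ts) = act (c h, Left) (c, h) # ts"
      by (rule map2_act_head)
  qed (use Nil assms(2) in \<open>auto simp: delta_def act_stay fun_upd_idem final_state_def
         intro: reaches_refl\<close>)
next
  case (Cons a v)
  have out: "tape_output (c, h + 1) v" "c h = Suc a"
    using Cons.prems by (auto simp: add.assoc dest: spec[of _ "Suc _"] spec[of _ 0])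
  let ?acts = "(stay (map read ((c, h) # ts)))[0 := (c h, Right)]"
  show ?case
    unfolding list.size(4) add_Suc_right add_0_right
  proof (rule reaches_machine[where acts = ?acts])
    show "map2 act ?acts ((c, h) # ts) = act (c h, Right) (c, h) # ts"
      by (rule map2_act_head)
    show "reaches machine (Suc (length v))
     (0, (act (c h, Right) (c, h) # ts) @ [(content (u @ [a]), int (length (u @ [a]))), Y, Z])
     (1, ((c, h + int (Suc (length v)) - 1) # ts) @
       [(content (u @ a # v), int (length (u @ a # v))), Y, Z])"
      using Cons.IH[OF out(1), of "u @ [a]"] by (simp add: fun_upd_idem add_ac)
  qed (use out assms(2) in \<open>auto simp: delta_def act_stay final_state_def content_snoc\<close>)
qed

lemma reaches_rewind_input:
  assumes "\<forall>i < k. c (int i) \<noteq> 0" "c (-1) = 0" "Suc (length ts) = num_tapes M"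
  shows "reaches machine (Suc k) (1, ((c, int k - 1) # ts) @ [X, Y, Z]) (2, ((c, 0) # ts) @ [X, Y, Z])"
  using assms(1)
proof (induction k)
  case 0
  let ?acts = "(stay (map read ((c, int 0 - 1) # ts)))[0 := (c (int 0 - 1), Right)]"
  show ?case
  proof (rule reaches_machine[where acts = ?acts])
    show "map2 act ?acts ((c, int 0 - 1) # ts) = act (c (int 0 - 1), Right) (c, int 0 - 1) # ts"
      by (rule map2_act_head)
  qed (use assms(2,3) in \<open>auto simp: delta_def act_stay fun_upd_idem final_state_def
         intro: reaches_refl\<close>)
next
  case (Suc k)
  let ?h = "int (Suc k) - 1"
  let ?acts = "(stay (map read ((c, ?h) # ts)))[0 := (c ?h, Left)]"
  show ?case
  proof (rule reaches_machine[where acts = ?acts])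
    show "map2 act ?acts ((c, ?h) # ts) = act (c ?h, Left) (c, ?h) # ts"
      by (rule map2_act_head)
    show "reaches machine (Suc k) (1, (act (c ?h, Left) (c, ?h) # ts) @ [X, Y, Z])
      (2, ((c, 0) # ts) @ [X, Y, Z])"
      using Suc by (simp add: fun_upd_idem)
  qed (use Suc.prems assms(3) in \<open>auto simp: delta_def act_stay final_state_def\<close>)
qed

lemma run_simulation:
  assumes "good_config M (0, ts)" "(step M ^^ t) (0, ts) = (s', ts')"
    and "\<And>i. i < t \<Longrightarrow> fst ((step M ^^ i) (0, ts)) < num_states M"
  shows "(step machine ^^ t) (2, ts @ [X, Y, Z]) = (s' + 2, ts' @ [X, Y, Z])"
  using assms(2,3)
proof (induction t arbitrary: s' ts')
  case (Suc t)
  obtain s1 ts1 where c1: "(step M ^^ t) (0, ts) = (s1, ts1)"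
    by (rule prod.exhaust)
  have IH: "(step machine ^^ t) (2, ts @ [X, Y, Z]) = (s1 + 2, ts1 @ [X, Y, Z])"
    using Suc.IH[OF c1] Suc.prems(2) by simp
  have s1: "s1 < num_states M"
    using Suc.prems(2)[of t] c1 by simp
  have good: "good_config M (s1, ts1)"
    using good_config_run[OF wf_M assms(1), of t] c1 by simp
  obtain s2 acts where tr: "trans M s1 (map read ts1) = (s2, acts)"
    by (rule prod.exhaust)
  note tg = trans_good[OF wf_M good s1 tr]
  have step: "s' = s2" "ts' = map2 act acts ts1"
    using Suc.prems(1) c1 s1 tr by auto
  have "step machine (s1 + 2, ts1 @ [X, Y, Z]) =
    (s2 + 2, map2 act acts ts1 @ [act (read X, Stay) X, act (read Y, Stay) Y, act (read Z, Stay) Z])"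
    by (rule step_machine)
      (use good tg tr s1 in \<open>auto simp: good_config_def delta_def copy_state_def final_state_def\<close>)
  then show ?case
    using IH step by (simp add: act_stay)
qed simp

lemma reaches_copy_output:
  assumes "tape_output (c, h) v" "Suc (length ts) = num_tapes M"
  shows "\<exists>ts'. length ts' = num_tapes M \<and> reaches machine (Suc (length v))
    (copy_state (\<exists>s \<in> set u. s < 2), (ts @ [(c, h)]) @ [(d, h'), (content u, int (length u)), Z])
    (emit_state (2 ^ m - 1) 0, ts' @ [(d, h' - 1),
      (content (ensure_bit (u @ v)), int (length (ensure_bit (u @ v))) - 1), Z])"
  using assms(1)
proof (induction v arbitrary: h u)
  case Nil
  let ?f = "\<exists>s \<in> set u. s < 2"
  let ?Y = "(content (ensure_bit u), int (length (ensure_bit u)) - 1)"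
  have "reaches machine (Suc 0)
    (copy_state ?f, (ts @ [(c, h)]) @ [(d, h'), (content u, int (length u)), Z])
    (emit_state (2 ^ m - 1) 0, (ts @ [(c, h)]) @ [(d, h' - 1), ?Y, Z])"
  proof (rule reaches_machine)
    show "delta (copy_state ?f) (map read (ts @ [(c, h)])) (read (d, h'))
       (read (content u, int (length u))) (read Z) =
      (emit_state (2 ^ m - 1) 0, stay (map read (ts @ [(c, h)])), (d h', Left),
        if ?f then (0, Left) else (1, Stay), (read Z, Stay))"
      using Nil by (simp add: delta_copy_state content_beyond)
    show "act (if ?f then (0, Left) else (1, Stay)) (content u, int (length u)) = ?Y"
      using content_snoc[of u 0] by (simp add: ensure_bit_def fun_upd_idem content_beyond)
  qed (use assms(2) in \<open>auto simp: map2_act_stay act_stay copy_state_def final_state_def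
      fun_upd_idem intro: reaches_refl simp del: map_append\<close>)
  then show ?case
    using assms(2) by (intro exI[of _ "ts @ [(c, h)]"]) simp
next
  case (Cons a v)
  let ?f = "\<exists>s \<in> set u. s < 2"
  have out: "tape_output (c, h + 1) v" "c h = Suc a"
    using Cons.prems by (auto simp: add.assoc dest: spec[of _ "Suc _"] spec[of _ 0])
  obtain ts' where ts': "length ts' = num_tapes M" "reaches machine (Suc (length v))
    (copy_state (\<exists>s \<in> set (u @ [a]). s < 2),
      (ts @ [(c, h + 1)]) @ [(d, h'), (content (u @ [a]), int (length (u @ [a]))), Z])
    (emit_state (2 ^ m - 1) 0, ts' @ [(d, h' - 1),
      (content (ensure_bit (u @ a # v)), int (length (ensure_bit (u @ a # v))) - 1), Z])"
    using Cons.IH[OF out(1), of "u @ [a]"] by auto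
  have f: "(?f \<or> Suc a \<le> 2) = (\<exists>s \<in> set (u @ [a]). s < 2)"
    by auto
  have "reaches machine (Suc (Suc (length v)))
    (copy_state ?f, (ts @ [(c, h)]) @ [(d, h'), (content u, int (length u)), Z])
    (emit_state (2 ^ m - 1) 0, ts' @ [(d, h' - 1),
      (content (ensure_bit (u @ a # v)), int (length (ensure_bit (u @ a # v))) - 1), Z])"
  proof (rule reaches_machine[OF _ _ _ _ _ _ _ _ ts'(2)])
    show "delta (copy_state ?f) (map read (ts @ [(c, h)])) (read (d, h'))
       (read (content u, int (length u))) (read Z) =
      (copy_state (\<exists>s \<in> set (u @ [a]). s < 2),
        (stay (map read (ts @ [(c, h)])))[length ts := (Suc a, Right)], (read (d, h'), Stay),
        (Suc a, Right), (read Z, Stay))"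
      unfolding f[symmetric] using out(2) by (simp add: delta_copy_state)
    show "map2 act ((stay (map read (ts @ [(c, h)])))[length ts := (Suc a, Right)]) (ts @ [(c, h)])
      = ts @ [(c, h + 1)]"
      unfolding map2_act_stay_update using out(2) by (simp add: fun_upd_idem)
    show "act (Suc a, Right) (content u, int (length u)) =
      (content (u @ [a]), int (length (u @ [a])))"
      by (simp add: content_snoc)
  qed (use assms(2) in \<open>auto simp: act_stay copy_state_def final_state_def fun_upd_idem\<close>)
  then show ?case
    using ts'(1) by auto
qed

lemma reaches_emit_code:
  assumes "a < 2 ^ m" "length ts = num_tapes M" "c h \<noteq> 0" "c h \<le> 2" "0 < j" "j \<le> m"
  shows "reaches machine (Suc m - j) (emit_state a j, ts @ [X, (c, h), out_tape w])
    (emit_state a 0, ts @ [X, (c, h - 1),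
       out_tape (map (\<lambda>i. of_bool (bit a i)) (rev [j - 1..<m]) @ w)])"
  using assms(5,6)
proof (induction "m - j" arbitrary: j w)
  case 0
  then have [simp]: "j = m" by simp
  have upt: "[m - 1..<m] = [m - 1]"
    using 0 by (cases m) simp_all
  have "reaches machine (Suc 0) (emit_state a m, ts @ [X, (c, h), out_tape w])
    (emit_state a 0, ts @ [X, (c, h - 1), out_tape (of_bool (bit a (m - 1)) # w)])"
    by (rule reaches_machine[OF delta_emit_state[of m, THEN trans]])
      (use 0 assms emit_state_less[OF assms(1), of m] in \<open>auto simp: map2_act_stay act_stay
         fun_upd_idem act_out_tape simp del: of_bool_eq intro: reaches_refl\<close>)
  then show ?case
    by (simp add: upt[unfolded One_nat_def])
next
  case (Suc k)
  then have j: "j < m" "0 < j" by auto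
  have upt: "[j - 1..<m] = (j - 1) # [j..<m]"
    using j by (metis Suc_diff_1 less_imp_diff_less upt_conv_Cons)
  have IH: "reaches machine (m - j) (emit_state a (Suc j), ts @ [X, (c, h), out_tape (of_bool (bit a (j - 1)) # w)])
    (emit_state a 0, ts @ [X, (c, h - 1),
       out_tape (map (\<lambda>i. of_bool (bit a i)) (rev [j..<m]) @ of_bool (bit a (j - 1)) # w)])"
    using Suc.hyps(1)[of "Suc j"] Suc.hyps(2) j by simp
  have "reaches machine (Suc (m - j)) (emit_state a j, ts @ [X, (c, h), out_tape w])
    (emit_state a 0, ts @ [X, (c, h - 1),
       out_tape (map (\<lambda>i. of_bool (bit a i)) (rev [j..<m]) @ of_bool (bit a (j - 1)) # w)])"
    by (rule reaches_machine[OF delta_emit_state[of j, THEN trans] _ _ _ _ _ _ _ IH])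
      (use j assms emit_state_less[OF assms(1), of j] in \<open>auto simp: map2_act_stay act_stay
         fun_upd_idem act_out_tape simp del: of_bool_eq\<close>)
  then show ?case
    using j by (simp add: upt[unfolded One_nat_def] Suc_diff_le)
qed

lemma reaches_emit_symbol:
  assumes "a < 2 ^ m" "length ts = num_tapes M" "c h = Suc s"
  shows "reaches machine (Suc m) (emit_state a 0, ts @ [X, (c, h), out_tape w])
    (emit_state a 0, ts @ [X, (c, h - 1), out_tape (pad_block m a s @ w)])"
proof (cases "s < 2 \<and> 0 < m")
  case True
  have IH: "reaches machine (Suc m - 1) (emit_state a 1, ts @ [X, (c, h), out_tape (s # w)])
    (emit_state a 0, ts @ [X, (c, h - 1), out_tape (pad_block m a s @ w)])"
    using reaches_emit_code[of a ts c h 1 X "s # w"] True assms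
    by (simp add: pad_block_def index_string_def)
  have "reaches machine (Suc (Suc m - 1)) (emit_state a 0, ts @ [X, (c, h), out_tape w])
    (emit_state a 0, ts @ [X, (c, h - 1), out_tape (pad_block m a s @ w)])"
    by (rule reaches_machine[OF delta_emit_state[of 0, THEN trans] _ _ _ _ _ _ _ IH])
      (use True assms emit_state_less[OF assms(1), of 0] in \<open>auto simp: map2_act_stay act_stay
         fun_upd_idem act_out_tape\<close>)
  then show ?thesis
    by simp
next
  case False
  have "reaches machine (Suc 0) (emit_state a 0, ts @ [X, (c, h), out_tape w])
    (emit_state a 0, ts @ [X, (c, h - 1), out_tape (s # w)])"
    by (rule reaches_machine[OF delta_emit_state[of 0, THEN trans]])
      (use False assms emit_state_less[OF assms(1), of 0] in \<open>auto simp: map2_act_stay act_stay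
         fun_upd_idem act_out_tape intro: reaches_refl\<close>)
  then show ?thesis
    using False by (auto simp: pad_block_def index_string_def elim: reaches_mono)
qed

lemma reaches_emit_copy:
  assumes "a < 2 ^ m" "length ts = num_tapes M" "k \<le> length y"
  shows "reaches machine (k * Suc m + 1) (emit_state a 0, ts @ [X, (content y, int k - 1), out_tape w])
    (next_state, ts @ [X, (content y, 0), out_tape (pad_copy m (take k y) a @ w)])"
  using assms(3)
proof (induction k arbitrary: w)
  case 0
  have "reaches machine (Suc 0) (emit_state a 0, ts @ [X, (content y, -1), out_tape w])
    (next_state, ts @ [X, (content y, 0), out_tape w])"
    by (rule reaches_machine[OF delta_emit_state[of 0, THEN trans]])
      (use assms emit_state_less[OF assms(1), of 0] in \<open>auto simp: map2_act_stay act_stay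
         content_beyond fun_upd_idem intro: reaches_refl\<close>)
  then show ?case
    by (simp add: pad_copy_def)
next
  case (Suc k)
  have "reaches machine (Suc m + (k * Suc m + 1))
    (emit_state a 0, ts @ [X, (content y, int k), out_tape w])
    (next_state, ts @ [X, (content y, 0),
      out_tape (pad_copy m (take k y) a @ pad_block m a (y ! k) @ w)])"
    using reaches_trans[OF reaches_emit_symbol[OF assms(1,2)] Suc.IH] Suc.prems
    by (simp add: content_nth)
  then show ?case
    using Suc.prems by (simp add: pad_copy_def take_Suc_conv_app_nth add_ac)
qed

lemma reaches_rewind_output:
  assumes "length ts = num_tapes M" "k \<le> length y"
  shows "reaches machine (length y - k) (next_state, ts @ [X, (content y, int k), Z])
    (next_state, ts @ [X, (content y, int (length y)), Z])"
  using assms(2)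
proof (induction "length y - k" arbitrary: k)
  case 0
  then show ?case
    by (simp add: reaches_refl)
next
  case (Suc n)
  have IH: "reaches machine n (next_state, ts @ [X, (content y, int k + 1), Z])
    (next_state, ts @ [X, (content y, int (length y)), Z])"
  proof -
    have k: "n = length y - Suc k" "Suc k \<le> length y"
      using Suc.hyps(2) by linarith+
    show ?thesis
      using Suc.hyps(1)[OF k] by (simp add: k(1) add.commute)
  qed
  show ?case
    unfolding Suc.hyps(2)[symmetric]
    by (rule reaches_machine[OF delta_next_state[THEN trans] _ _ _ _ _ _ _ IH])
      (use Suc.hyps(2) assms(1) state_order in \<open>auto simp: map2_act_stay act_stay
         content_nth fun_upd_idem\<close>)
qed

lemma reaches_emit_all:
  assumes "length ts = num_tapes M" "k \<le> length x" "set x \<subseteq> {..<2 ^ m}"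
  shows "\<exists>ts'. reaches machine (k * (length y * Suc m + length y + 2) + length y + 1)
    (next_state, ts @ [(content x, int k - 1), (content y, 0), out_tape w])
    (final_state, ts' @ [act (0, Right) (out_tape (concat (map (pad_copy m y) (take k x)) @ w))])"
  using assms(2)
proof (induction k arbitrary: w)
  case 0
  have "reaches machine (Suc 0)
    (next_state, ts @ [(content x, -1), (content y, int (length y)), out_tape w])
    (final_state, ts @ [(content x, -1), (content y, int (length y)), act (0, Right) (out_tape w)])"
    by (rule reaches_machine[OF delta_next_state[THEN trans]])
      (use assms(1) state_order in \<open>auto simp: map2_act_stay act_stay read_out_tape
         content_beyond fun_upd_idem intro: reaches_refl\<close>)
  from reaches_trans[OF reaches_rewind_output[OF assms(1), of 0 y] this]
  show ?case
    by (intro exI[of _ "ts @ [(content x, -1), (content y, int (length y))]"]) simp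
next
  case (Suc k)
  let ?a = "x ! k" and ?n = "length y"
  have a: "?a < 2 ^ m"
    using assms(3) Suc.prems nth_mem[of k x] by (meson Suc_le_lessD lessThan_iff subsetD)
  obtain ts' where IH:
    "reaches machine (k * (length y * Suc m + length y + 2) + length y + 1)
      (next_state, ts @ [(content x, int k - 1), (content y, 0), out_tape (pad_copy m y ?a @ w)])
      (final_state, ts' @ [act (0, Right)
         (out_tape (concat (map (pad_copy m y) (take k x)) @ pad_copy m y ?a @ w))])"
    using Suc.IH[of "pad_copy m y ?a @ w"] Suc.prems by auto
  have fetch: "reaches machine (Suc 0)
    (next_state, ts @ [(content x, int k), (content y, int ?n), out_tape w])
    (emit_state ?a 0, ts @ [(content x, int k - 1), (content y, int ?n - 1), out_tape w])"
    by (rule reaches_machine[OF delta_next_state[THEN trans]])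
      (use assms(1) a state_order Suc.prems in \<open>auto simp: map2_act_stay act_stay content_nth
         content_beyond fun_upd_idem min_def intro: reaches_refl\<close>)
  note run = reaches_trans[OF reaches_trans[OF reaches_trans[OF
      reaches_rewind_output[OF assms(1) le0, of y] fetch]
      reaches_emit_copy[OF a assms(1) order_refl, of y, unfolded take_all[OF order_refl]]] IH]
  have "reaches machine (?n - 0 + Suc 0 + (?n * Suc m + 1) + (k * (?n * Suc m + ?n + 2) + ?n + 1))
    (next_state, ts @ [(content x, int k), (content y, 0), out_tape w])
    (final_state, ts' @ [act (0, Right)
         (out_tape (concat (map (pad_copy m y) (take k x)) @ pad_copy m y ?a @ w))])"
    using run by simp
  then show ?case
    using Suc.prems by (intro exI[of _ ts']) (simp add: take_Suc_conv_app_nth algebra_simps)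
qed

lemma machine_computes:
  assumes "x \<in> lists {..<q}" "q < num_symbols M" "q < 2 ^ m" "computes_within M x y t"
  shows "computes_within machine x (pad m y x)
    (2 * length x + t + (length x + t) + 3 +
      (length x + 1) * ((length x + t + 1) * Suc m + (length x + t + 1) + 2))"
proof -
  let ?n = "length x" and ?y = "ensure_bit y" and ?mark = "2 ^ m - 1 :: nat"
  let ?halted = "\<lambda>i. fst ((step M ^^ i) (start_config M x)) = num_states M"
  have good: "good_config M ((step M ^^ i) (start_config M x))" for i
    by (intro good_config_run good_config_start[OF wf_M assms(1,2)] wf_M)
  have "?halted t"
    using assms(4) by (auto simp: computes_within_def)
  define t0 where "t0 = (LEAST i. ?halted i)"
  have t0: "t0 \<le> t" "?halted t0" "\<And>i. i < t0 \<Longrightarrow> \<not> ?halted i"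
    using Least_le[of ?halted, OF \<open>?halted t\<close>] LeastI[of ?halted, OF \<open>?halted t\<close>]
      not_less_Least[of _ ?halted] unfolding t0_def by blast+
  obtain ts where ts: "(step M ^^ t0) (start_config M x) = (num_states M, ts)"
    using t0(2) by (metis prod.collapse)
  have "(step M ^^ t) (start_config M x) = (step M ^^ (t - t0 + t0)) (start_config M x)"
    using t0 by simp
  also have "\<dots> = (num_states M, ts)"
    unfolding funpow_add using ts step_halted[of "num_states M" M] by simp
  finally have y: "tape_output (last ts) y"
    using assms(4) by (simp add: computes_within_def)
  have running: "fst ((step M ^^ i) (start_config M x)) < num_states M" if "i < t0" for i
    using t0(3)[OF that] good[of i] by (auto simp: good_config_def split: prod.splits)
  have len_ts: "length ts = num_tapes M"
    using good[of t0] ts by (simp add: good_config_def)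
  then have "ts \<noteq> []"
    using wf_M by (auto simp: wf_tm_def)
  then obtain us c h where us: "ts = us @ [(c, h)]"
    by (metis append_butlast_last_id prod.exhaust)
  have "length y \<le> ?n + t0"
    using length_output_le[OF ts _ y] \<open>ts \<noteq> []\<close> by simp
  then have len_y: "length y \<le> ?n + t"
    using t0 by simp
  then have len_y': "length ?y \<le> ?n + t + 1"
    by (simp add: ensure_bit_def)
  let ?bs = "replicate (num_tapes M - 1) blank_tape"
  have bs: "Suc (length ?bs) = num_tapes M"
    using wf_M by (simp add: wf_tm_def)
  have out: "tape_output (content x, 0) x"
    by (simp add: content_def)
  have start: "start_config machine x =
    (0, ((content x, 0) # ?bs) @ [(content [], 0), blank_tape, blank_tape])"
  proof -
    have "replicate (num_tapes M + 2) blank_tape =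
      ?bs @ [(content [], 0), blank_tape, blank_tape]"
    proof -
      have b: "(content [], 0) = blank_tape"
        by (auto simp: content_def blank_tape_def)
      have "num_tapes M + 2 = (num_tapes M - 1) + 3"
        using bs by simp
      then show ?thesis
        unfolding b by (simp only: replicate_add) (simp add: numeral_3_eq_3)
    qed
    then show ?thesis
      by (simp add: start_config_def machine_def input_tape_content)
  qed
  have p1: "reaches machine (Suc ?n) (start_config machine x)
    (1, ((content x, int ?n - 1) # ?bs) @ [(content x, int ?n), blank_tape, blank_tape])"
    using reaches_copy_input[OF out bs, of "[]" blank_tape blank_tape]
    by (simp add: start[unfolded One_nat_def])
  have p2: "reaches machine (Suc ?n)
    (1, ((content x, int ?n - 1) # ?bs) @ [(content x, int ?n), blank_tape, blank_tape])
    (2, ((content x, 0) # ?bs) @ [(content x, int ?n), blank_tape, blank_tape])"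
    by (rule reaches_rewind_input[OF _ _ bs]) (auto simp: content_def)
  have start_M: "start_config M x = (0, (content x, 0) # ?bs)"
    by (simp add: start_config_def input_tape_content)
  have p3: "reaches machine t
    (2, ((content x, 0) # ?bs) @ [(content x, int ?n), blank_tape, blank_tape])
    (copy_state False, ts @ [(content x, int ?n), (content [], 0), blank_tape])"
    unfolding reaches_def
    using run_simulation[OF good[of 0, simplified, unfolded start_M] ts[unfolded start_M]
        running[unfolded start_M]] t0(1)
    by (intro exI[of _ t0]) (simp add: copy_state_def content_Nil blank_tape_def)
  obtain vs where vs: "length vs = num_tapes M" "reaches machine (Suc (length y))
    (copy_state False, ts @ [(content x, int ?n), (content [], 0), blank_tape])
    (emit_state ?mark 0, vs @ [(content x, int ?n - 1), (content ?y, int (length ?y) - 1), blank_tape])"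
    using reaches_copy_output[of c h y us "[]" "content x" "int ?n" blank_tape] y us len_ts by auto
  have p5: "reaches machine (length ?y * Suc m + 1)
    (emit_state ?mark 0, vs @ [(content x, int ?n - 1), (content ?y, int (length ?y) - 1), blank_tape])
    (next_state, vs @ [(content x, int ?n - 1), (content ?y, 0), out_tape (pad_copy m ?y ?mark)])"
    using reaches_emit_copy[of ?mark vs "length ?y" ?y _ "[]"] vs(1) by (simp add: out_tape_Nil)
  have "set x \<subseteq> {..<2 ^ m}"
    using assms(1,3) by auto
  then obtain ws where p6:
    "reaches machine (?n * (length ?y * Suc m + length ?y + 2) + length ?y + 1)
    (next_state, vs @ [(content x, int ?n - 1), (content ?y, 0), out_tape (pad_copy m ?y ?mark)])
    (final_state, ws @ [act (0, Right) (out_tape (pad m y x))])"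
    using reaches_emit_all[OF vs(1), of ?n x ?y "pad_copy m ?y ?mark"] by (auto simp: pad_def)
  let ?L = "?n + t + 1"
  define B where "B = ?L * Suc m + ?L + 2"
  have B: "length ?y * Suc m + length ?y + 2 \<le> B"
    unfolding B_def using len_y' by (intro add_mono mult_le_mono1) auto
  then have "?n * (length ?y * Suc m + length ?y + 2) \<le> ?n * B"
    by (rule mult_le_mono2)
  moreover have "(?n + 1) * B = ?n * B + B"
    by simp
  ultimately have "Suc ?n + Suc ?n + t + Suc (length y) + (length ?y * Suc m + 1) +
      (?n * (length ?y * Suc m + length ?y + 2) + length ?y + 1)
    \<le> 2 * ?n + t + (?n + t) + 3 + (?n + 1) * B"
    using len_y B by linarith
  then have "reaches machine (2 * ?n + t + (?n + t) + 3 + (?n + 1) * B)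
    (start_config machine x) (final_state, ws @ [act (0, Right) (out_tape (pad m y x))])"
    by (rule reaches_mono[rotated])
      (rule reaches_trans[OF reaches_trans[OF reaches_trans[OF reaches_trans[OF
        reaches_trans[OF p1 p2] p3] vs(2)] p5] p6])
  then have "reaches machine (2 * ?n + t + (?n + t) + 3 + (?n + 1) * B)
    (start_config machine x) (num_states machine, ws @ [act (0, Right) (out_tape (pad m y x))])"
    by (simp add: machine_def)
  from reaches_halted[OF this] show ?thesis
    unfolding B_def using tape_output_out_tape by (simp add: computes_within_def)
qed

end

lemma polytime_pad:
  assumes "polytime q f" "q < 2 ^ m"
  shows "polytime q (\<lambda>x. pad m (f x) x)"
proof -
  obtain M and p :: "nat poly" where M: "wf_tm M" "q < num_symbols M"
    "\<And>x. x \<in> lists {..<q} \<Longrightarrow> computes_within M x (f x) (poly p (length x))"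
    using assms(1) unfolding polytime_def by blast
  interpret pad_machine M m
    by standard (rule M(1))
  let ?X = "[:0, 1:] :: nat poly"
  let ?p = "2 * ?X + p + (?X + p) + 3 + (?X + 1) * ((?X + p + 1) * [:Suc m:] + (?X + p + 1) + 2)"
  have p: "poly ?p n = 2 * n + poly p n + (n + poly p n) + 3 +
      (n + 1) * ((n + poly p n + 1) * Suc m + (n + poly p n + 1) + 2)" for n
    by (simp add: algebra_simps)
  have "computes_within machine x (pad m (f x) x) (poly ?p (length x))" if "x \<in> lists {..<q}" for x
    unfolding p by (rule machine_computes[OF that M(2) assms(2) M(3)[OF that]])
  moreover have "q < num_symbols machine"
    using M(2) by (simp add: machine_def)
  ultimately show ?thesis
    unfolding polytime_def using wf_machine by blast
qed

section \<open>Circuits on disjoint registers\<close>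

lemma bits_value_snoc: "bits_value (qs @ [q]) S = 2 * bits_value qs S + of_bool (q \<in> S)"
  by (simp add: bits_value_def)

lemma bits_value_cong: "S \<inter> set qs = S' \<inter> set qs \<Longrightarrow> bits_value qs S = bits_value qs S'"
  by (induction qs rule: rev_induct) (auto simp: bits_value_snoc bits_value_def)

lemma bits_value_less: "bits_value qs S < 2 ^ length qs"
  by (induction qs rule: rev_induct) (auto simp: bits_value_snoc bits_value_def)

lemma bits_value_eqD: "bits_value qs S = bits_value qs S' \<Longrightarrow> S \<inter> set qs = S' \<inter> set qs"
proof (induction qs rule: rev_induct)
  case (snoc q qs)
  have "q \<in> S \<longleftrightarrow> q \<in> S'" "bits_value qs S = bits_value qs S'"
    using snoc.prems unfolding bits_value_snoc by (auto simp: of_bool_def split: if_splits) presburger+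
  with snoc.IH show ?case
    by auto
qed simp

lemma bits_value_bij:
  assumes "distinct qs"
  shows "bij_betw (bits_value qs) (Pow (set qs)) {..<2 ^ length qs}"
proof -
  have inj: "inj_on (bits_value qs) (Pow (set qs))"
    by (rule inj_onI) (use bits_value_eqD in blast)
  have "bits_value qs ` Pow (set qs) = {..<2 ^ length qs}"
  proof (rule card_subset_eq)
    show "card (bits_value qs ` Pow (set qs)) = card {..<(2::nat) ^ length qs}"
      using assms by (simp add: card_image[OF inj] card_Pow distinct_card)
  qed (auto simp: bits_value_less)
  with inj show ?thesis
    by (simp add: bij_betw_def)
qed

lemma bits_value_map:
  assumes "set qs \<subseteq> I"
  shows "bits_value (map \<phi> qs) S = bits_value qs {i \<in> I. \<phi> i \<in> S}"
  using assms
  by (induction qs rule: rev_induct) (auto simp: bits_value_snoc bits_value_def)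

lemma unitary_norm:
  assumes U: "U \<in> carrier_mat n n" "mat_adjoint U * U = 1\<^sub>m n"
  shows "(\<Sum>i<n. (cmod (\<Sum>j<n. U $$ (i, j) * w j))\<^sup>2) = (\<Sum>j<n. (cmod (w j))\<^sup>2)"
proof -
  have orth: "(\<Sum>i<n. cnj (U $$ (i, k)) * U $$ (i, j)) = of_bool (k = j)" if "k < n" "j < n" for k j
  proof -
    have "(\<Sum>i<n. cnj (U $$ (i, k)) * U $$ (i, j)) = (mat_adjoint U * U) $$ (k, j)"
      using U(1) that by (simp add: mat_adjoint_def scalar_prod_def atLeast0LessThan mat_of_rows_def)
    then show ?thesis
      using that by (simp add: U(2))
  qed
  have "complex_of_real (\<Sum>i<n. (cmod (\<Sum>j<n. U $$ (i, j) * w j))\<^sup>2) =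
    (\<Sum>i<n. (\<Sum>j<n. U $$ (i, j) * w j) * (\<Sum>k<n. cnj (U $$ (i, k)) * cnj (w k)))"
    unfolding of_real_sum complex_norm_square by simp
  also have "\<dots> = (\<Sum>i<n. \<Sum>j<n. \<Sum>k<n. w j * cnj (w k) * (cnj (U $$ (i, k)) * U $$ (i, j)))"
    by (simp add: sum_product mult_ac)
  also have "\<dots> = (\<Sum>j<n. \<Sum>k<n. \<Sum>i<n. w j * cnj (w k) * (cnj (U $$ (i, k)) * U $$ (i, j)))"
    by (subst sum.swap, rule sum.cong[OF refl], rule sum.swap)
  also have "\<dots> = (\<Sum>j<n. \<Sum>k<n. w j * cnj (w k) * of_bool (k = j))"
    by (intro sum.cong refl) (simp add: orth flip: sum_distrib_left)
  also have "\<dots> = (\<Sum>j<n. w j * cnj (w j))"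
    by (intro sum.cong refl) (simp add: of_bool_def if_distrib sum.delta cong: if_cong)
  also have "\<dots> = complex_of_real (\<Sum>j<n. (cmod (w j))\<^sup>2)"
    unfolding of_real_sum complex_norm_square ..
  finally show ?thesis
    by (simp only: of_real_eq_iff)
qed

definition norm_on :: "nat set \<Rightarrow> state \<Rightarrow> real" where
  "norm_on W \<psi> = (\<Sum>S \<in> Pow W. (cmod (\<psi> S))\<^sup>2)"

lemma sum_Pow_split:
  assumes "finite W" "V \<subseteq> W"
  shows "(\<Sum>S \<in> Pow W. f S) = (\<Sum>R \<in> Pow (W - V). \<Sum>A \<in> Pow V. f (R \<union> A))"
  unfolding sum.cartesian_product
  by (rule sum.reindex_bij_witness[where i = "\<lambda>(R, A). R \<union> A" and j = "\<lambda>S. (S - V, S \<inter> V)"])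
    (use assms in \<open>auto simp: Int_absorb2 Un_Diff_Int intro: arg_cong[of _ _ f]\<close>)

lemma norm_on_apply_gate:
  assumes "finite W" "set qs \<subseteq> W" "distinct qs"
    and U: "U \<in> carrier_mat (2 ^ length qs) (2 ^ length qs)" "mat_adjoint U * U = 1\<^sub>m (2 ^ length qs)"
  shows "norm_on W (apply_gate U qs \<psi>) = norm_on W \<psi>"
proof -
  let ?V = "set qs" and ?b = "bits_value qs" and ?n = "2 ^ length qs :: nat"
  note bij = bits_value_bij[OF assms(3)]
  define dec where "dec = the_inv_into (Pow ?V) ?b"
  have dec: "dec (?b A) = A" if "A \<subseteq> ?V" for A
    unfolding dec_def using bij that by (intro the_inv_into_f_f) (auto simp: bij_betw_def)
  have "(\<Sum>S \<in> Pow ?V. (cmod (apply_gate U qs \<psi> (R \<union> S)))\<^sup>2) = (\<Sum>A \<in> Pow ?V. (cmod (\<psi> (R \<union> A)))\<^sup>2)"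
    if R: "R \<subseteq> W - ?V" for R
  proof -
    have "apply_gate U qs \<psi> (R \<union> S) = (\<Sum>j<?n. U $$ (?b S, j) * \<psi> (R \<union> dec j))" if "S \<subseteq> ?V" for S
    proof -
      have "R \<union> S - ?V = R" "?b (R \<union> S) = ?b S"
        using R that by (auto intro!: bits_value_cong)
      then have "apply_gate U qs \<psi> (R \<union> S) = (\<Sum>A \<in> Pow ?V. U $$ (?b S, ?b A) * \<psi> (R \<union> dec (?b A)))"
        unfolding apply_gate_def by (intro sum.cong) (auto simp: dec)
      also have "\<dots> = (\<Sum>j<?n. U $$ (?b S, j) * \<psi> (R \<union> dec j))"
        by (rule sum.reindex_bij_betw[OF bij])
      finally show ?thesis .
    qed
    then have "(\<Sum>S \<in> Pow ?V. (cmod (apply_gate U qs \<psi> (R \<union> S)))\<^sup>2) =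
      (\<Sum>S \<in> Pow ?V. (cmod (\<Sum>j<?n. U $$ (?b S, j) * \<psi> (R \<union> dec j)))\<^sup>2)"
      by simp
    also have "\<dots> = (\<Sum>i<?n. (cmod (\<Sum>j<?n. U $$ (i, j) * \<psi> (R \<union> dec j)))\<^sup>2)"
      by (rule sum.reindex_bij_betw[OF bij])
    also have "\<dots> = (\<Sum>j<?n. (cmod (\<psi> (R \<union> dec j)))\<^sup>2)"
      by (rule unitary_norm[OF U])
    also have "\<dots> = (\<Sum>A \<in> Pow ?V. (cmod (\<psi> (R \<union> dec (?b A))))\<^sup>2)"
      by (rule sum.reindex_bij_betw[OF bij, symmetric])
    finally show ?thesis
      by (simp add: dec)
  qed
  then show ?thesis
    unfolding norm_on_def sum_Pow_split[OF assms(1,2)] by simp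
qed

lemma apply_gate_relabel:
  assumes inj: "inj_on \<phi> I" and qs: "set qs \<subseteq> I"
  shows "apply_gate U (map \<phi> qs) (\<lambda>S. f (S - \<phi> ` I) * \<chi> {i \<in> I. \<phi> i \<in> S}) =
    (\<lambda>S. f (S - \<phi> ` I) * apply_gate U qs \<chi> {i \<in> I. \<phi> i \<in> S})"
proof
  fix S
  let ?V = "set qs" and ?S = "{i \<in> I. \<phi> i \<in> S}"
  have pow: "Pow (set (map \<phi> qs)) = (`) \<phi> ` Pow ?V"
    by (simp add: image_Pow_surj)
  have inj': "inj_on ((`) \<phi>) (Pow ?V)"
    using inj qs by (intro inj_on_image_Pow) (rule inj_on_subset)
  have pre: "{i \<in> I. \<phi> i \<in> \<phi> ` A} = A" if "A \<subseteq> ?V" for A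
    using that qs inj by (auto dest: inj_onD)
  have arg: "{i \<in> I. \<phi> i \<in> S - \<phi> ` ?V \<union> \<phi> ` A} = (?S - ?V) \<union> A" if "A \<subseteq> ?V" for A
    using that qs inj by (auto dest: inj_onD)
  have rest: "S - \<phi> ` ?V \<union> \<phi> ` A - \<phi> ` I = S - \<phi> ` I" if "A \<subseteq> ?V" for A
    using that qs by auto
  have "apply_gate U (map \<phi> qs) (\<lambda>S. f (S - \<phi> ` I) * \<chi> {i \<in> I. \<phi> i \<in> S}) S =
    (\<Sum>A \<in> Pow ?V. U $$ (bits_value qs ?S, bits_value qs A) *
      (f (S - \<phi> ` I) * \<chi> ((?S - ?V) \<union> A)))"
    unfolding apply_gate_def pow sum.reindex[OF inj'] o_def
    by (intro sum.cong refl) (simp add: rest arg[simplified] bits_value_map[OF qs] pre)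
  also have "\<dots> = f (S - \<phi> ` I) * apply_gate U qs \<chi> ?S"
    by (simp add: apply_gate_def sum_distrib_left mult_ac)
  finally show "apply_gate U (map \<phi> qs) (\<lambda>S. f (S - \<phi> ` I) * \<chi> {i \<in> I. \<phi> i \<in> S}) S =
    f (S - \<phi> ` I) * apply_gate U qs \<chi> ?S" .
qed

lemma apply_gate_disjoint:
  assumes "set qs \<inter> P = {}"
  shows "apply_gate U qs (\<lambda>S. f (S - P) * g (S \<inter> P)) = (\<lambda>S. apply_gate U qs f (S - P) * g (S \<inter> P))"
proof
  fix S
  have b: "bits_value qs (S - P) = bits_value qs S"
    using assms by (intro bits_value_cong) auto
  have "S - set qs \<union> A - P = (S - P - set qs) \<union> A" "(S - set qs \<union> A) \<inter> P = S \<inter> P"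
    if "A \<subseteq> set qs" for A
    using assms that by auto
  then show "apply_gate U qs (\<lambda>S. f (S - P) * g (S \<inter> P)) S = apply_gate U qs f (S - P) * g (S \<inter> P)"
    unfolding apply_gate_def sum_distrib_right b by (intro sum.cong refl) (simp add: mult.assoc)
qed

definition relabel :: "(nat \<Rightarrow> nat) \<Rightarrow> circuit \<Rightarrow> circuit" where
  "relabel \<phi> C = map (\<lambda>(g, qs). (g, map \<phi> qs)) C"

definition qubits :: "circuit \<Rightarrow> nat set" where
  "qubits C = (\<Union>(g, qs) \<in> set C. set qs)"

lemma qubits_Nil [simp]: "qubits [] = {}"
  and qubits_Cons [simp]: "qubits ((g, qs) # C) = set qs \<union> qubits C"
  and qubits_append [simp]: "qubits (C @ D) = qubits C \<union> qubits D"
  by (auto simp: qubits_def)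

lemma qubits_relabel: "qubits (relabel \<phi> C) = \<phi> ` qubits C"
  by (induction C) (auto simp: relabel_def)

lemma finite_qubits: "finite (qubits C)"
  by (auto simp: qubits_def)

lemma run_Cons: "run T ((g, qs) # C) \<psi> = run T C (apply_gate (T ! g) qs \<psi>)"
  by (simp add: run_def)

lemma run_append: "run T (C @ D) \<psi> = run T D (run T C \<psi>)"
  by (simp add: run_def)

lemma run_relabel:
  assumes "inj_on \<phi> I" "qubits C \<subseteq> I"
  shows "run T (relabel \<phi> C) (\<lambda>S. f (S - \<phi> ` I) * \<chi> {i \<in> I. \<phi> i \<in> S}) =
    (\<lambda>S. f (S - \<phi> ` I) * run T C \<chi> {i \<in> I. \<phi> i \<in> S})"
  using assms(2)
proof (induction C arbitrary: \<chi>)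
  case Nil
  then show ?case by (simp add: run_def relabel_def)
next
  case (Cons c C)
  obtain g qs where c: "c = (g, qs)" by (rule prod.exhaust)
  have "relabel \<phi> (c # C) = (g, map \<phi> qs) # relabel \<phi> C"
    by (simp add: relabel_def c)
  then show ?case
    using Cons c by (simp add: run_Cons apply_gate_relabel[OF assms(1)])
qed

lemma run_disjoint:
  assumes "qubits C \<inter> P = {}"
  shows "run T C (\<lambda>S. f (S - P) * g (S \<inter> P)) = (\<lambda>S. run T C f (S - P) * g (S \<inter> P))"
  using assms
proof (induction C arbitrary: f)
  case Nil
  then show ?case by (simp add: run_def)
next
  case (Cons c C)
  obtain h qs where c: "c = (h, qs)" by (rule prod.exhaust)
  have "set qs \<inter> P = {}" "qubits C \<inter> P = {}"
    using Cons.prems c by auto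
  then show ?case
    using Cons.IH c by (simp add: run_Cons apply_gate_disjoint)
qed

definition gates_fit :: "complex mat list \<Rightarrow> circuit \<Rightarrow> bool" where
  "gates_fit T C \<longleftrightarrow>
     (\<forall>(g, qs) \<in> set C. g < length T \<and> distinct qs \<and> dim_row (T ! g) = 2 ^ length qs)"

lemma gate_unitary:
  assumes "gateset T" "g < length T" "dim_row (T ! g) = 2 ^ k"
  shows "1 \<le> k" "T ! g \<in> carrier_mat (2 ^ k) (2 ^ k)" "mat_adjoint (T ! g) * (T ! g) = 1\<^sub>m (2 ^ k)"
proof -
  obtain j where j: "1 \<le> j" "T ! g \<in> carrier_mat (2 ^ j) (2 ^ j)" "mat_adjoint (T ! g) * (T ! g) = 1\<^sub>m (2 ^ j)"
    using assms(1,2) unfolding gateset_def by (meson nth_mem)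
  then have "j = k"
    using assms(3) by simp
  with j show "1 \<le> k" "T ! g \<in> carrier_mat (2 ^ k) (2 ^ k)" "mat_adjoint (T ! g) * (T ! g) = 1\<^sub>m (2 ^ k)"
    by auto
qed

lemma norm_on_run:
  assumes "gateset T" "gates_fit T C" "finite W" "qubits C \<subseteq> W"
  shows "norm_on W (run T C \<psi>) = norm_on W \<psi>"
  using assms(2,4)
proof (induction C arbitrary: \<psi>)
  case Nil
  then show ?case by (simp add: run_def)
next
  case (Cons c C)
  obtain g qs where c: "c = (g, qs)" by (rule prod.exhaust)
  have g: "g < length T" "distinct qs" "dim_row (T ! g) = 2 ^ length qs" and C: "gates_fit T C"
    using Cons.prems c by (auto simp: gates_fit_def)
  show ?case
    using Cons.IH[OF C] Cons.prems c
      norm_on_apply_gate[OF assms(3) _ g(2) gate_unitary(2,3)[OF assms(1) g(1,3)]]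
    by (simp add: run_Cons)
qed

lemma norm_on_basis_state: "finite W \<Longrightarrow> B \<subseteq> W \<Longrightarrow> norm_on W (basis_state B) = 1"
  by (simp add: norm_on_def basis_state_def if_distrib[of cmod] if_distrib[of "\<lambda>z. z\<^sup>2"] sum.delta cong: if_cong)

lemma last_outcome_prob_relabel:
  fixes C D :: circuit and \<phi> :: "nat \<Rightarrow> nat"
  defines "n \<equiv> num_qubits C" and "C' \<equiv> D @ relabel \<phi> C"
  defines "n' \<equiv> num_qubits C'"
  assumes T: "gateset T" and D: "gates_fit T D" and C: "qubits C \<subseteq> {..<n}" "qubits C' \<subseteq> {..<n'}"
    and inj: "inj_on \<phi> {..<n}" "\<phi> ` {..<n} \<subseteq> {..<n'}" and disj: "qubits D \<inter> \<phi> ` {..<n} = {}"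
    and last: "\<phi> (n - 1) = n' - 1" and pos: "0 < n"
  shows "last_outcome_prob T C' {} b = last_outcome_prob T C {} b"
proof -
  let ?I = "{..<n}" and ?P = "\<phi> ` {..<n}" and ?W = "{..<n'} - \<phi> ` {..<n}"
  let ?F = "run T D (basis_state {})" and ?G = "run T C (basis_state {})"
  have "basis_state {} = (\<lambda>S. basis_state {} (S - ?P) * basis_state {} (S \<inter> ?P))"
    by (rule ext) (auto simp: basis_state_def)
  then have "run T D (basis_state {}) = (\<lambda>S. ?F (S - ?P) * basis_state {} (S \<inter> ?P))"
    using run_disjoint[OF disj, of T "basis_state {}" "basis_state {}"] by simp
  also have "\<dots> = (\<lambda>S. ?F (S - ?P) * basis_state {} {i \<in> ?I. \<phi> i \<in> S})"
    by (rule ext) (auto simp: basis_state_def)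
  finally have FG: "run T C' (basis_state {}) = (\<lambda>S. ?F (S - ?P) * ?G {i \<in> ?I. \<phi> i \<in> S})"
    unfolding C'_def run_append using run_relabel[OF inj(1) C(1), of T ?F "basis_state {}"] by simp
  have mem: "n' - 1 \<in> S \<longleftrightarrow> n - 1 \<in> {i \<in> ?I. \<phi> i \<in> S}" for S
    using last pos by auto
  have norm: "norm_on ?W ?F = 1"
  proof -
    have W: "finite ?W" "qubits D \<subseteq> ?W"
      using C(2) disj by (auto simp: C'_def)
    show ?thesis
      unfolding norm_on_run[OF T D W] by (rule norm_on_basis_state) auto
  qed
  have inj': "\<phi> i \<in> \<phi> ` B \<longleftrightarrow> i \<in> B" if "i < n" "B \<subseteq> ?I" for i B
    using inj(1) that by (auto dest: inj_onD)
  have "last_outcome_prob T C' {} b = (\<Sum>S | S \<subseteq> {..<n'} \<and> (n' - 1 \<in> S \<longleftrightarrow> b).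
      (cmod (?F (S - ?P)))\<^sup>2 * (cmod (?G {i \<in> ?I. \<phi> i \<in> S}))\<^sup>2)"
    by (simp add: last_outcome_prob_def outcome_prob_def FG Let_def n'_def norm_mult power_mult_distrib)
  also have "\<dots> = (\<Sum>(A, B) \<in> Pow ?W \<times> {B. B \<subseteq> ?I \<and> (n - 1 \<in> B \<longleftrightarrow> b)}.
      (cmod (?F A))\<^sup>2 * (cmod (?G B))\<^sup>2)"
  proof (rule sum.reindex_bij_witness[where i = "\<lambda>(A, B). A \<union> \<phi> ` B" and j = "\<lambda>S. (S - ?P, {i \<in> ?I. \<phi> i \<in> S})"])
    fix S assume S: "S \<in> {S. S \<subseteq> {..<n'} \<and> (n' - 1 \<in> S \<longleftrightarrow> b)}"
    show "(case (S - ?P, {i \<in> ?I. \<phi> i \<in> S}) of (A, B) \<Rightarrow> A \<union> \<phi> ` B) = S"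
      by auto
    show "(S - ?P, {i \<in> ?I. \<phi> i \<in> S}) \<in> Pow ?W \<times> {B. B \<subseteq> ?I \<and> (n - 1 \<in> B \<longleftrightarrow> b)}"
      using S mem[of S] by auto
  next
    fix p assume "p \<in> Pow ?W \<times> {B. B \<subseteq> ?I \<and> (n - 1 \<in> B \<longleftrightarrow> b)}"
    then obtain A B where p: "p = (A, B)" "A \<subseteq> ?W" "B \<subseteq> ?I" "n - 1 \<in> B \<longleftrightarrow> b"
      by auto
    have B: "{i \<in> ?I. \<phi> i \<in> A \<union> \<phi> ` B} = B"
    proof -
      have "{i \<in> ?I. \<phi> i \<in> A \<union> \<phi> ` B} = {i \<in> ?I. \<phi> i \<in> \<phi> ` B}"
        using p(2) by blast
      also have "\<dots> = B"
        using inj'[OF _ p(3)] p(3) by auto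
      finally show ?thesis .
    qed
    moreover have "A \<union> \<phi> ` B - ?P = A"
      using p(2,3) by auto
    ultimately show "((case p of (A, B) \<Rightarrow> A \<union> \<phi> ` B) - ?P,
        {i \<in> ?I. \<phi> i \<in> (case p of (A, B) \<Rightarrow> A \<union> \<phi> ` B)}) = p"
      by (simp add: p(1))
    have "A \<union> \<phi> ` B \<subseteq> {..<n'}"
      using p(2,3) inj(2) by auto
    then show "(case p of (A, B) \<Rightarrow> A \<union> \<phi> ` B) \<in> {S. S \<subseteq> {..<n'} \<and> (n' - 1 \<in> S \<longleftrightarrow> b)}"
      using p(4) mem[of "A \<union> \<phi> ` B"] unfolding B by (simp add: p(1))
  qed auto
  also have "\<dots> = norm_on ?W ?F * (\<Sum>B | B \<subseteq> ?I \<and> (n - 1 \<in> B \<longleftrightarrow> b). (cmod (?G B))\<^sup>2)"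
    unfolding norm_on_def sum_product sum.cartesian_product by simp
  also have "\<dots> = last_outcome_prob T C {} b"
    unfolding norm by (simp add: last_outcome_prob_def outcome_prob_def Let_def n_def)
  finally show ?thesis .
qed

section \<open>Padded circuits\<close>

fun spread :: "nat \<Rightarrow> nat \<Rightarrow> nat \<Rightarrow> nat \<Rightarrow> nat" where
  "spread m a 0 i = 0"
| "spread m a (Suc l) i = spread m a l (i div 2) * 2 ^ Suc m + (2 * a + i mod 2)"

lemma index_string_Suc: "index_string (Suc l) i = index_string l (i div 2) @ [i mod 2]"
proof -
  have "rev [0..<Suc l] = map Suc (rev [0..<l]) @ [0]"
    by (simp only: upt_conv_Cons[OF zero_less_Suc] map_Suc_upt[symmetric] rev.simps rev_map)
  then show ?thesis
    by (simp add: index_string_def o_def bit_Suc bit_0 mod_2_eq_odd)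
qed

lemma length_index_string [simp]: "length (index_string l i) = l"
  by (simp add: index_string_def)

lemma set_index_string: "set (index_string l i) \<subseteq> {..<2}"
  by (auto simp: index_string_def)

lemma index_string_append:
  "w < 2 ^ k \<Longrightarrow> index_string (l + k) (h * 2 ^ k + w) = index_string l h @ index_string k w"
proof (induction k arbitrary: w)
  case 0
  then show ?case by (simp add: index_string_def)
next
  case (Suc k)
  have "h * 2 ^ Suc k + w = 2 * (h * 2 ^ k) + w"
    by simp
  then have "(h * 2 ^ Suc k + w) div 2 = h * 2 ^ k + w div 2" "(h * 2 ^ Suc k + w) mod 2 = w mod 2"
    by presburger+
  then show ?case
    using Suc.IH[of "w div 2"] Suc.prems by (simp add: index_string_Suc)
qed

lemma index_string_inject:
  "index_string l i = index_string l j \<Longrightarrow> i < 2 ^ l \<Longrightarrow> j < 2 ^ l \<Longrightarrow> i = j"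
proof (induction l arbitrary: i j)
  case (Suc l)
  then have "i div 2 = j div 2" "i mod 2 = j mod 2"
    by (auto simp: index_string_Suc)
  then show ?case
    by (metis div_mult_mod_eq)
qed simp

lemma block_less: "a < 2 ^ m \<Longrightarrow> 2 * a + i mod 2 < 2 ^ Suc m" for a i m :: nat
  by simp

lemma index_string_spread:
  assumes "a < 2 ^ m"
  shows "index_string (l * Suc m) (spread m a l i) = concat (map (pad_block m a) (index_string l i))"
proof (induction l arbitrary: i)
  case 0
  show ?case by (simp add: index_string_def)
next
  case (Suc l)
  have "index_string (Suc l * Suc m) (spread m a (Suc l) i) =
    index_string (l * Suc m) (spread m a l (i div 2)) @ index_string (Suc m) (2 * a + i mod 2)"
    unfolding spread.simps mult_Suc add.commute[of "Suc m"]
    by (rule index_string_append[OF block_less[OF assms]])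
  also have "index_string (Suc m) (2 * a + i mod 2) = pad_block m a (i mod 2)"
    by (simp add: index_string_Suc pad_block_def)
  finally show ?case
    unfolding Suc by (simp add: index_string_Suc)
qed

lemma spread_less:
  assumes "a < 2 ^ m"
  shows "spread m a l i < 2 ^ (l * Suc m)"
proof (induction l arbitrary: i)
  case (Suc l)
  have "spread m a (Suc l) i < (spread m a l (i div 2) + 1) * 2 ^ Suc m"
    using block_less[OF assms, of i] by simp
  also have "\<dots> \<le> 2 ^ (l * Suc m) * 2 ^ Suc m"
    using Suc[of "i div 2"] by (intro mult_le_mono1) simp
  also have "\<dots> = 2 ^ (Suc l * Suc m)"
    by (simp add: power_add mult_ac)
  finally show ?case .
qed simp

lemma digit_less:
  fixes s t u v b :: nat
  assumes "s < t" "u < b"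
  shows "s * b + u < t * b + v"
proof -
  have "s * b + u < Suc s * b"
    using assms by simp
  also have "\<dots> \<le> t * b"
    using assms by (intro mult_le_mono1) simp
  finally show ?thesis
    by simp
qed

lemma spread_strict_mono:
  assumes "a < 2 ^ m"
  shows "i < j \<Longrightarrow> j < 2 ^ l \<Longrightarrow> spread m a l i < spread m a l j"
proof (induction l arbitrary: i j)
  case (Suc l)
  show ?case
  proof (cases "i div 2 = j div 2")
    case True
    then have "i mod 2 < j mod 2"
      using Suc.prems(1) by presburger
    with True show ?thesis
      by simp
  next
    case False
    then have i: "i div 2 < j div 2"
      using Suc.prems(1) by presburger
    have j: "j div 2 < 2 ^ l"
      using Suc.prems(2) by (intro less_mult_imp_div_less) simp
    from digit_less[OF Suc.IH[OF i j] block_less[OF assms]] show ?thesis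
      by simp
  qed
qed simp

lemma spread_less_spread:
  assumes "a < a'" "a' < 2 ^ m"
  shows "0 < l \<Longrightarrow> spread m a l i < spread m a' l j"
proof (induction l arbitrary: i j)
  case (Suc l)
  have "a < 2 ^ m"
    using assms by simp
  show ?case
  proof (cases "l = 0")
    case True
    have "i mod 2 < 2"
      by simp
    with True assms(1) show ?thesis
      by (simp del: mod_less_divisor)
  next
    case False
    from digit_less[OF Suc.IH block_less[OF \<open>a < 2 ^ m\<close>]] False show ?thesis
      by simp
  qed
qed simp

lemma spread_mark_ge:
  assumes "0 < m"
  shows "0 < l \<Longrightarrow> 2 ^ (l * Suc m - 1) \<le> spread m (2 ^ m - 1) l i"
proof (induction l arbitrary: i)
  case (Suc l)
  show ?case
  proof (cases "l = 0")
    case True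
    obtain k where "m = Suc k"
      using assms gr0_implies_Suc by blast
    then have "2 ^ m \<le> 2 * (2 ^ m - 1 :: nat)"
      by simp
    with True show ?thesis
      by simp
  next
    case False
    have "2 ^ (Suc l * Suc m - 1) = 2 ^ (l * Suc m - 1) * (2 ^ Suc m :: nat)"
    proof -
      have "0 < l * Suc m"
        using False by simp
      then have "Suc l * Suc m - 1 = (l * Suc m - 1) + Suc m"
        unfolding mult_Suc by linarith
      then show ?thesis
        by (simp only: power_add)
    qed
    also have "\<dots> \<le> spread m (2 ^ m - 1) l (i div 2) * 2 ^ Suc m"
      using Suc.IH[of "i div 2"] False by (intro mult_le_mono1) simp
    finally show ?thesis
      by simp
  qed
qed simp

lemma index_length_properties: "0 < index_length n" "n \<le> 2 ^ index_length n"
proof -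
  have "n \<le> 2 ^ Suc n"
    using less_exp[of "Suc n"] by linarith
  then have "0 < index_length n \<and> n \<le> 2 ^ index_length n"
    unfolding index_length_def using LeastI[of "\<lambda>l. 0 < l \<and> n \<le> 2 ^ l" "Suc n"] by simp
  then show "0 < index_length n" "n \<le> 2 ^ index_length n"
    by auto
qed

lemma index_length_eqI:
  assumes "0 < l" "n \<le> 2 ^ l" "2 ^ (l - 1) < n"
  shows "index_length n = l"
  unfolding index_length_def
proof (rule Least_equality)
  fix k assume k: "0 < k \<and> n \<le> 2 ^ k"
  show "l \<le> k"
  proof (rule ccontr)
    assume "\<not> l \<le> k"
    then have "(2::nat) ^ k \<le> 2 ^ (l - 1)"
      by (intro power_increasing) auto
    with k assms(3) show False
      by simp
  qed
qed (use assms in simp)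

definition encode_with :: "nat \<Rightarrow> circuit \<Rightarrow> nat list" where
  "encode_with l C = concat (map (\<lambda>(g, qs). (g + 2) # concat (map (index_string l) qs)) C)"

lemma encode_eq: "encode C = encode_with (index_length (num_qubits C)) C"
  by (simp add: encode_def encode_with_def Let_def)

lemma encode_with_append: "encode_with l (C @ D) = encode_with l C @ encode_with l D"
  by (simp add: encode_with_def)

lemma encode_with_concat: "encode_with l (concat Cs) = concat (map (encode_with l) Cs)"
  by (induction Cs) (simp_all add: encode_with_append encode_with_def)

lemma concat_map_concat: "concat (map f (concat xss)) = concat (map (\<lambda>xs. concat (map f xs)) xss)"
  by (induction xss) simp_all

lemma encode_with_relabel:
  assumes "a < 2 ^ m"
  shows "encode_with (l * Suc m) (relabel (spread m a l) C) = pad_copy m (encode_with l C) a"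
proof -
  have idx: "concat (map (index_string (l * Suc m)) (map (spread m a l) qs)) =
    concat (map (pad_block m a) (concat (map (index_string l) qs)))" for qs
    by (simp add: concat_map_concat o_def index_string_spread[OF assms] del: mult_Suc_right)
  have "(case (case p of (g, qs) \<Rightarrow> (g, map (spread m a l) qs)) of
      (g, qs) \<Rightarrow> (g + 2) # concat (map (index_string (l * Suc m)) qs)) =
    concat (map (pad_block m a) (case p of (g, qs) \<Rightarrow> (g + 2) # concat (map (index_string l) qs)))" for p
  proof (cases p)
    case (Pair g qs)
    have "pad_block m a (g + 2) = [g + 2]"
      by (simp add: pad_block_def)
    then show ?thesis
      by (simp only: Pair prod.case idx list.map concat.simps append.simps)
  qed
  then show ?thesis
    unfolding encode_with_def pad_copy_def concat_map_concat relabel_def map_map o_def by simp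
qed

definition pad_circuit :: "nat \<Rightarrow> circuit \<Rightarrow> nat list \<Rightarrow> circuit" where
  "pad_circuit m C x = (let l = index_length (num_qubits C) in
     concat (map (\<lambda>a. relabel (spread m a l) C) x) @ relabel (spread m (2 ^ m - 1) l) C)"

lemma qubits_concat: "qubits (concat Cs) = (\<Union>C \<in> set Cs. qubits C)"
  by (auto simp: qubits_def)

lemma num_qubits_eq: "num_qubits C = Suc (Max (qubits C))"
  by (simp add: num_qubits_def qubits_def)

lemma qubits_less: "qubits C \<subseteq> {..<num_qubits C}"
  using Max_ge[OF finite_qubits] by (auto simp: num_qubits_eq less_Suc_eq_le)

lemma valid_circuit_iff: "valid_circuit T C \<longleftrightarrow> C \<noteq> [] \<and> gates_fit T C"
  by (simp add: valid_circuit_def gates_fit_def)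

lemma gates_fit_relabel:
  assumes "gates_fit T C" "inj_on \<phi> (qubits C)"
  shows "gates_fit T (relabel \<phi> C)"
proof -
  have "g < length T \<and> distinct (map \<phi> qs) \<and> dim_row (T ! g) = 2 ^ length (map \<phi> qs)"
    if "(g, qs) \<in> set C" for g qs
  proof -
    have "set qs \<subseteq> qubits C"
      using that by (auto simp: qubits_def)
    then show ?thesis
      using that assms by (auto simp: gates_fit_def distinct_map intro: inj_on_subset)
  qed
  then show ?thesis
    by (auto simp: gates_fit_def relabel_def)
qed

lemma valid_circuit_gate:
  assumes "gateset T" "valid_circuit T C"
  obtains g q qs C' where "C = (g, q # qs) # C'"
proof -
  obtain g qs C' where C: "C = (g, qs) # C'"
    using assms(2) by (cases C) (auto simp: valid_circuit_def)
  then have "g < length T" "dim_row (T ! g) = 2 ^ length qs"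
    using assms(2) by (auto simp: valid_circuit_def)
  from gate_unitary(1)[OF assms(1) this] C that show ?thesis
    by (cases qs) auto
qed

lemma gates_fit_concat: "(\<And>D. D \<in> set Cs \<Longrightarrow> gates_fit T D) \<Longrightarrow> gates_fit T (concat Cs)"
  by (fastforce simp: gates_fit_def)

lemma ensure_bit_encode:
  assumes "gateset T" "valid_circuit T C"
  shows "ensure_bit (encode C) = encode C"
proof -
  obtain g q qs C' where gq: "C = (g, q # qs) # C'"
    by (rule valid_circuit_gate[OF assms])
  obtain l' where "index_length (num_qubits C) = Suc l'"
    using index_length_properties(1) gr0_implies_Suc by blast
  then have "q mod 2 \<in> set (encode C)"
    unfolding encode_eq by (simp add: encode_with_def gq index_string_Suc)
  moreover have "q mod 2 < 2"
    by simp
  ultimately show ?thesis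
    unfolding ensure_bit_def by meson
qed

context
  fixes T :: "complex mat list" and C :: circuit and x :: "nat list" and m :: nat
  assumes T: "gateset T" and C: "valid_circuit T C" and x: "x \<in> lists {..<2 ^ m - 1}" and m: "0 < m"
begin

private abbreviation "mark \<equiv> 2 ^ m - 1 :: nat"
private abbreviation "n \<equiv> num_qubits C"
private abbreviation "l \<equiv> index_length (num_qubits C)"
private abbreviation "pads \<equiv> concat (map (\<lambda>a. relabel (spread m a l) C) x)"

private lemma pad_circuit_eq: "pad_circuit m C x = pads @ relabel (spread m mark l) C"
  by (simp add: pad_circuit_def Let_def)

private lemma mark_less: "mark < 2 ^ m"
  by simp

private lemma symbol_less: "a \<in> set x \<Longrightarrow> a < mark" "a \<in> set x \<Longrightarrow> a < 2 ^ m"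
  using x by (auto dest: less_imp_diff_less)

private lemma spread_inj: "a < 2 ^ m \<Longrightarrow> inj_on (spread m a l) {..<n}"
proof (rule linorder_inj_onI')
  fix i j assume "a < 2 ^ m" "i \<in> {..<n}" "j \<in> {..<n}" "i < j"
  then show "spread m a l i \<noteq> spread m a l j"
    using spread_strict_mono[of a m i j l] index_length_properties(2)[of n] by auto
qed

private lemma qubits_nonempty: "qubits C \<noteq> {}"
  by (rule valid_circuit_gate[OF T C]) auto

private lemma last_qubit: "n - 1 \<in> qubits C"
  using Max_in[OF finite_qubits qubits_nonempty] by (simp add: num_qubits_eq)

private lemma spread_le_last:
  "i < n \<Longrightarrow> a \<in> insert mark (set x) \<Longrightarrow> spread m a l i \<le> spread m mark l (n - 1)"
proof -
  assume i: "i < n" and a: "a \<in> insert mark (set x)"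
  show ?thesis
  proof (cases "a = mark")
    case True
    show ?thesis
    proof (cases "i = n - 1")
      case False
      then have "i < n - 1" "n - 1 < 2 ^ l"
        using i index_length_properties(2)[of n] by linarith+
      from spread_strict_mono[OF mark_less this] True show ?thesis
        by simp
    qed (use True in simp)
  next
    case False
    then have "a < mark"
      using a symbol_less by auto
    from spread_less_spread[OF this mark_less index_length_properties(1)] show ?thesis
      by (simp add: less_imp_le)
  qed
qed

private lemma qubits_pad_circuit:
  "qubits (pad_circuit m C x) = (\<Union>a \<in> insert mark (set x). spread m a l ` qubits C)"
  by (auto simp: pad_circuit_eq qubits_concat qubits_relabel)

private lemma num_qubits_pad_circuit: "num_qubits (pad_circuit m C x) = Suc (spread m mark l (n - 1))"
proof -
  have "Max (qubits (pad_circuit m C x)) = spread m mark l (n - 1)"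
  proof (rule Max_eqI[OF finite_qubits])
    show "spread m mark l (n - 1) \<in> qubits (pad_circuit m C x)"
      using last_qubit by (auto simp: qubits_pad_circuit)
    fix j assume "j \<in> qubits (pad_circuit m C x)"
    then obtain a i where "a \<in> insert mark (set x)" "i \<in> qubits C" "j = spread m a l i"
      by (auto simp: qubits_pad_circuit)
    then show "j \<le> spread m mark l (n - 1)"
      using spread_le_last[of i a] qubits_less[of C] by auto
  qed
  then show ?thesis
    by (simp add: num_qubits_eq)
qed

private lemma index_length_pad_circuit: "index_length (num_qubits (pad_circuit m C x)) = l * Suc m"
  unfolding num_qubits_pad_circuit
proof (rule index_length_eqI)
  show "Suc (spread m mark l (n - 1)) \<le> 2 ^ (l * Suc m)"
    using spread_less[OF mark_less] by (rule Suc_leI)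
  show "2 ^ (l * Suc m - 1) < Suc (spread m mark l (n - 1))"
    using spread_mark_ge[OF m index_length_properties(1)] by (rule le_imp_less_Suc)
qed (use index_length_properties(1)[of n] in simp)

lemma encode_pad_circuit: "encode (pad_circuit m C x) = pad m (encode C) x"
proof -
  have "encode (pad_circuit m C x) = concat (map (\<lambda>a. encode_with (l * Suc m) (relabel (spread m a l) C)) x) @
      encode_with (l * Suc m) (relabel (spread m mark l) C)"
    unfolding encode_eq index_length_pad_circuit
    by (simp add: pad_circuit_eq encode_with_append encode_with_concat o_def)
  also have "\<dots> = concat (map (pad_copy m (encode_with l C)) x) @ pad_copy m (encode_with l C) mark"
    using symbol_less(2) by (simp add: encode_with_relabel del: mult_Suc_right cong: map_cong)
  finally show ?thesis
    unfolding pad_def ensure_bit_encode[OF T C] by (simp add: encode_eq)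
qed

private lemma gates_fit_copy: "a < 2 ^ m \<Longrightarrow> gates_fit T (relabel (spread m a l) C)"
  using C by (intro gates_fit_relabel inj_on_subset[OF spread_inj qubits_less]) (simp_all add: valid_circuit_iff)

private lemma gates_fit_pads: "gates_fit T pads"
  using gates_fit_copy symbol_less(2) by (intro gates_fit_concat) auto

lemma valid_pad_circuit: "valid_circuit T (pad_circuit m C x)"
  using gates_fit_pads gates_fit_copy[OF mark_less] C
  by (auto simp: valid_circuit_iff pad_circuit_eq relabel_def gates_fit_def)

lemma last_outcome_prob_pad_circuit:
  "last_outcome_prob T (pad_circuit m C x) {} b = last_outcome_prob T C {} b"
  unfolding pad_circuit_eq
proof (rule last_outcome_prob_relabel[OF T gates_fit_pads qubits_less qubits_less spread_inj[OF mark_less]],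
    fold pad_circuit_eq, unfold num_qubits_pad_circuit)
  show "spread m mark l ` {..<n} \<subseteq> {..<Suc (spread m mark l (n - 1))}"
    using spread_le_last by (auto simp: less_Suc_eq_le)
  have "spread m a l i \<noteq> spread m mark l j" if "a \<in> set x" for a i j
    using spread_less_spread[OF symbol_less(1)[OF that] mark_less index_length_properties(1), of n i j] by simp
  then show "qubits pads \<inter> spread m mark l ` {..<n} = {}"
    by (auto simp: qubits_concat qubits_relabel) metis
qed (simp_all add: num_qubits_eq)

end

section \<open>The injective reduction\<close>

lemma concat_replicate_inject:
  assumes "0 < k" "concat (map (replicate k) u) = concat (map (replicate k) v)"
  shows "u = v"
  using assms(2)
proof (induction u arbitrary: v)
  case Nil
  with assms(1) show ?case by (cases v) auto
next
  case (Cons a u)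
  from Cons.prems assms(1) obtain b w where v: "v = b # w"
    by (cases v) auto
  from Cons.prems v have "replicate k a = replicate k b"
    "concat (map (replicate k) u) = concat (map (replicate k) w)"
    by auto
  with assms(1) Cons.IH v show ?case
    by (auto simp: replicate_eq_replicate)
qed

lemma blocks_inject:
  assumes "concat (map (\<lambda>(a, s). index_string m a @ [s]) u) = concat (map (\<lambda>(a, s). index_string m a @ [s]) v)"
    and "fst ` set u \<subseteq> {..<2 ^ m}" "fst ` set v \<subseteq> {..<2 ^ m}"
  shows "u = v"
  using assms
proof (induction u arbitrary: v)
  case Nil
  then show ?case by (cases v) auto
next
  case (Cons p u)
  from Cons.prems(1) obtain p' w where v: "v = p' # w"
    by (cases v) (auto split: prod.splits)
  obtain a s a' s' where p: "p = (a, s)" "p' = (a', s')"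
    by fastforce
  have "index_string m a = index_string m a'" "s = s'"
    "concat (map (\<lambda>(a, s). index_string m a @ [s]) u) = concat (map (\<lambda>(a, s). index_string m a @ [s]) w)"
    using Cons.prems(1) by (auto simp: v p)
  moreover from this have "a = a'"
    using Cons.prems(2,3) by (intro index_string_inject) (auto simp: v p)
  ultimately show ?case
    using Cons.IH[of w] Cons.prems v p by auto
qed

lemma filter_bits_pad_copy:
  "filter (\<lambda>s. s < 2) (pad_copy m y a) =
    concat (map (\<lambda>(a, s). index_string m a @ [s]) (map (Pair a) (filter (\<lambda>s. s < 2) y)))"
proof -
  have "filter (\<lambda>s. s < 2) (index_string m a) = index_string m a"
    using set_index_string by (intro filter_True) auto
  then show ?thesis
    by (induction y) (auto simp: pad_copy_def pad_block_def)
qed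

text \<open>The bits of \<open>pad m y x\<close> fall into blocks of length \<open>Suc m\<close>.  The number of blocks that carry the
  final marker is the number \<open>k\<close> of bits of \<open>y\<close>, and the other markers form \<open>x\<close> with every symbol
  repeated \<open>k\<close> times.\<close>

lemma pad_inject:
  assumes eq: "pad m y x = pad m y' x'" and "x \<in> lists {..<2 ^ m - 1}" "x' \<in> lists {..<2 ^ m - 1}"
  shows "x = x'"
proof -
  define mark where "mark = (2 ^ m - 1 :: nat)"
  define bits where "bits = (\<lambda>y. filter (\<lambda>s. s < 2) (ensure_bit y))"
  define W where "W = (\<lambda>y x. concat (map (\<lambda>a. map (Pair a) (bits y)) (x @ [mark])))"
  have mark: "mark < 2 ^ m" "set x \<subseteq> {..<mark}" "set x' \<subseteq> {..<mark}"
    using assms(2,3) by (auto simp: mark_def)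
  have filter_W: "filter (\<lambda>s. s < 2) (pad m y x) = concat (map (\<lambda>(a, s). index_string m a @ [s]) (W y x))" for y x
    unfolding W_def concat_map_concat pad_def filter_concat map_map
    by (simp add: filter_bits_pad_copy bits_def mark_def o_def)
  have range_W: "fst ` set (W y x) \<subseteq> {..<2 ^ m}" if "set x \<subseteq> {..<mark}" for y x
    using that mark(1) by (auto simp: W_def)
  have "W y x = W y' x'"
  proof (rule blocks_inject[of m])
    show "concat (map (\<lambda>(a, s). index_string m a @ [s]) (W y x)) = concat (map (\<lambda>(a, s). index_string m a @ [s]) (W y' x'))"
      using eq filter_W by metis
  qed (use range_W mark in auto)
  then have "map fst (W y x) = map fst (W y' x')"
    by simp
  moreover have "map fst (W y x) = concat (map (replicate (length (bits y))) (x @ [mark]))" for y x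
    by (simp add: W_def map_concat o_def map_replicate_const)
  ultimately have rep: "concat (map (replicate (length (bits y))) (x @ [mark])) =
      concat (map (replicate (length (bits y'))) (x' @ [mark]))"
    by simp
  have count: "count_list (concat (map (replicate k) (x @ [mark]))) mark = k" if "set x \<subseteq> {..<mark}" for k x
  proof -
    have "mark \<notin> set (concat (map (replicate k) x))"
      using that by auto
    then have "count_list (concat (map (replicate k) x)) mark = 0"
      by (simp add: count_list_0_iff)
    moreover have "count_list (replicate k mark) mark = k"
      by (induction k) auto
    ultimately show ?thesis
      by (simp add: count_list_append)
  qed
  have len: "length (bits y) = length (bits y')"
    using count[OF mark(2)] count[OF mark(3)] rep by metis
  have "bits y \<noteq> []"
    by (auto simp: bits_def ensure_bit_def filter_empty_conv)
  then have "0 < length (bits y)"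
    by simp
  from concat_replicate_inject[OF this rep[folded len]] show ?thesis
    by simp
qed

lemma set_pad: "set (pad m y x) \<subseteq> {..<2} \<union> set y"
proof -
  have "set (ensure_bit y) \<subseteq> {..<2} \<union> set y"
    by (auto simp: ensure_bit_def)
  moreover have "set (pad_block m a s) \<subseteq> insert s {..<2}" for a s
    using set_index_string[of m a] by (auto simp: pad_block_def)
  ultimately show ?thesis
    unfolding pad_def pad_copy_def by (simp add: subset_iff) blast
qed

theorem theorem2:
  fixes T :: "complex mat list"
  assumes "gateset T"
    and "promiseBQP_complete (sDCS T)"
  shows "\<forall>L \<in> promiseBQP. \<exists>R.
    polytime_reduction L (sDCS T) R \<and> inj_on R (lists {..<alph L})"
proof
  fix L assume L: "L \<in> promiseBQP"
  then obtain R0 where R0: "polytime_reduction L (sDCS T) R0"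
    using assms(2) unfolding promiseBQP_complete_def by blast
  define m where "m = Suc (alph L)"
  define R where "R = (\<lambda>x. pad m (R0 x) x)"
  have "alph L < 2 ^ alph L"
    by (rule less_exp)
  then have m: "0 < m" "alph L < 2 ^ m" "alph L \<le> 2 ^ m - 1"
    unfolding m_def power_Suc by linarith+
  have symbols: "x \<in> lists {..<2 ^ m - 1}" if "x \<in> lists {..<alph L}" for x
    using that m(3) by auto
  have wf_L: "wf_problem L"
    using L by (simp add: promiseBQP_def)
  have wf_B: "wf_problem (sDCS T)"
    using assms(2) by (simp add: promiseBQP_complete_def promiseBQP_def)
  have pad: "\<exists>C'. pad m (encode C) x = encode C' \<and> sDCS_promise T C' \<and>
      last_outcome_prob T C' {} True = last_outcome_prob T C {} True"
    if C: "sDCS_promise T C" and x: "x \<in> lists {..<alph L}" for C x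
  proof -
    have valid: "valid_circuit T C"
      using C by (simp add: sDCS_promise_def)
    note * = assms(1) valid symbols[OF x] m(1)
    show ?thesis
      using C encode_pad_circuit[OF *] valid_pad_circuit[OF *] last_outcome_prob_pad_circuit[OF *]
      by (intro exI[of _ "pad_circuit m C x"]) (simp add: sDCS_promise_def)
  qed
  have yes: "R x \<in> yes (sDCS T)" if R0x: "R0 x \<in> yes (sDCS T)" and x: "x \<in> lists {..<alph L}" for x
  proof -
    obtain C where C: "R0 x = encode C" "sDCS_promise T C" "2/3 \<le> last_outcome_prob T C {} True"
      using R0x by (auto simp: sDCS_def)
    from pad[OF C(2) x] show ?thesis
      using C(1,3) by (auto simp: sDCS_def R_def)
  qed
  have no: "R x \<in> no (sDCS T)" if R0x: "R0 x \<in> no (sDCS T)" and x: "x \<in> lists {..<alph L}" for x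
  proof -
    obtain C where C: "R0 x = encode C" "sDCS_promise T C" "\<not> 2/3 \<le> last_outcome_prob T C {} True"
      using R0x by (auto simp: sDCS_def)
    from pad[OF C(2) x] show ?thesis
      using C(1,3) by (auto simp: sDCS_def R_def)
  qed
  have "polytime_reduction L (sDCS T) R"
    unfolding polytime_reduction_def
  proof (intro conjI ballI)
    show "polytime (alph L) R"
      using R0 polytime_pad[OF _ m(2)] by (simp add: polytime_reduction_def R_def)
    have "R x \<in> lists {..<alph (sDCS T)}" if x: "x \<in> lists {..<alph L}" for x
    proof -
      have "set (R0 x) \<subseteq> {..<alph (sDCS T)}"
        using R0 x by (auto simp: polytime_reduction_def)
      moreover have "{..<2} \<subseteq> {..<alph (sDCS T)}"
        by (auto simp: sDCS_def)
      ultimately have "set (R x) \<subseteq> {..<alph (sDCS T)}"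
        unfolding R_def by (intro order_trans[OF set_pad] Un_least)
      then show ?thesis
        by (simp add: lists_eq_set)
    qed
    then show "R ` lists {..<alph L} \<subseteq> lists {..<alph (sDCS T)}"
      by (rule image_subsetI)
    fix x assume x: "x \<in> yes L \<union> no L"
    then have x': "x \<in> lists {..<alph L}"
      using wf_L by (auto simp: wf_problem_def)
    have R0x: "R0 x \<in> yes (sDCS T) \<union> no (sDCS T)" "x \<in> yes L \<longleftrightarrow> R0 x \<in> yes (sDCS T)"
      using R0 x by (auto simp: polytime_reduction_def)
    show "R x \<in> yes (sDCS T) \<union> no (sDCS T)"
      using R0x(1) yes[OF _ x'] no[OF _ x'] by blast
    show "x \<in> yes L \<longleftrightarrow> R x \<in> yes (sDCS T)"
      using R0x yes[OF _ x'] no[OF _ x'] wf_B unfolding wf_problem_def by blast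
  qed
  moreover have "inj_on R (lists {..<alph L})"
    by (rule inj_onI) (use pad_inject symbols in \<open>auto simp: R_def\<close>)
  ultimately show "\<exists>R. polytime_reduction L (sDCS T) R \<and> inj_on R (lists {..<alph L})"
    by blast
qed

end
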